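(* Let $J$ satisfy (A1)–(A3), let the admissible metric families $\mathcal D_1,\dots,\mathcal D_N$ satisfy (B1)–(B3), and let $\{z^k\}_{k\in\mathbb N}$, $z^k=(x_1^k,\dots,x_N^k)$, be the sequence generated by the iGGBPL algorithm with step sizes satisfying $\inf_{i\in[N],k\ge1}(\gamma_i^k-1)s_i^k>0$ and $\inf_{i\in[N],k\ge1}\sigma_i^k>0$ (all described in the context). Let $J^*=\lim_{k\to\infty}J(z^k)$. Then there exists a constant $C_{\mathrm{it}}>0$, independent of $K$, such that for every integer $K\ge1$, $$\min_{1\le k\le K}\mathrm{dist}^2(0,\partial J(z^{k+1}))\le\frac{C_{\mathrm{it}}\,(J(z^1)-J^* )}{K}.$$ Consequently, the smallest $k\ge1$ with $\mathrm{dist}^2(0,\partial J(z^{k+1}))\le\varepsilon$ is $\mathcal O(\varepsilon^{-1})$ as $\varepsilon\to0^+$, and the smallest $k\ge1$ with $\mathrm{dist}(0,\partial J(z^{k+1}))\le\varepsilon$ is $\mathcal O(\varepsilon^{-2})$ as $\varepsilon\to0^+$. The same assertions hold for the sequence generated by the GGBPL algorithm.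
   Context: Notation: $[N]=\{1,\dots,N\}$; $\langle\cdot,\cdot\rangle,\|\cdot\|$ are the Euclidean inner product and norm; $\mathrm{dist}(x,S)=\inf_{y\in S}\|x-y\|$. Problem. Minimize $J(x_1,\dots,x_N)=H(x_1,\dots,x_N)+\sum_{i=1}^N F_i(x_i)$ over $\prod_{i=1}^N\mathbb R^{d_i}$. Assumptions: (A1) $H:\prod_i\mathbb R^{d_i}\to\mathbb R$ is continuously differentiable; for each $i$ and each choice of the other blocks, the partial gradient $x_i\mapsto\nabla_{x_i}H$ is Lipschitz on $\mathbb R^{d_i}$; and $\nabla H$ is Lipschitz on every bounded set. (A2) Each $F_i:\mathbb R^{d_i}\to(-\infty,+\infty]$ (equal to $+\infty$ outside a set $\mathbb D_{F_i}$) is proper, lower semicontinuous and bounded below. (A3) $J$ is a KŁ function, proper, coercive ($J(x)\to+\infty$ as $\|x\|\to\infty$) and bounded below. Subdifferentials and KŁ. The Fréchet subdifferential $\hat\partial f(x)$ of a proper lsc $f$ at $x\in\mathrm{dom} f$ is the set of $u$ with $\liminf_{y\to x,y\ne x}\frac{f(y)-f(x)-\langle u,y-x\rangle}{\|y-x\|}\ge0$ (empty if $x\notin\mathrm{dom} f$); the limiting subdifferential is $\partial f(x)=\{u:\exists x^k\to x, f(x^k)\to f(x), u^k\in\hat\partial f(x^k), u^k\to u\}$. A desingularization function is a concave continuous $\phi:[0,\eta)\to\mathbb R_+$ with $\phi(0)=0$, continuously differentiable on $(0,\eta)$ with $\phi'>0$. $f$ is a KŁ function if for every $\bar u$ with $\partial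 f(\bar u)\neq\emptyset$ there exist $\eta\in(0,+\infty]$, a neighborhood $U$ of $\bar u$ and a desingularization function $\phi$ on $[0,\eta)$ such that $\phi'(f(u)-f(\bar u))\,\mathrm{dist}(0,\partial f(u))\ge1$ for all $u\in U$ with $f(\bar u)<f(u)<f(\bar u)+\eta$. Admissible metrics. For each $i\in[N]$, $\mathcal D_i$ is a family of metrics on $\mathbb R^{d_i}$ such that: (B1) there exist a norm $\|\cdot\|_d$ (on $\mathbb R^{d_i}$) and a constant $C_d>0$ with $C_d\|x-y\|_d\le d(x,y)$ for all $x,y\in\mathbb R^{d_i}$, $d\in\mathcal D_i$; (B2) $d(\cdot,y)$ is convex for every $y\in\mathbb R^{d_i}$, $d\in\mathcal D_i$; (B3) $\omega_i(x,y):=\sup_{d\in\mathcal D_i}d(x,y)$ is bounded on every compact subset of $\mathbb R^{d_i}\times\mathbb R^{d_i}$. iGGBPL algorithm. Input: $x^1_{(N)}=x^0_{(N)}\in\mathrm{dom}\,J$, where $x^k_{(N)}=(x_1^k,\dots,x_N^k)$; $\rho_1>0$, $\beta^1=0$, $t_1=1$. For $k=1,2,3,\dots$: (1) Set $y_i^k=x_i^k+\beta^k(x_i^k-x_i^{k-1})$ for all $i$. (2) For $i=1,\dots,N$ successively: put $h_i(c)=H(x_1^{k+1},\dots,x_{i-1}^{k+1},c,x_{i+1}^k,\dots,x_N^k)$; choose any inner product $\langle u,v\rangle_{i,k}=\langle R_{i,k}u,v\rangle$ on $\mathbb R^{d_i}$ ($R_{i,k}$ symmetric positive definite) and any $d_i^k\in\mathcal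 D_i$; let $L_{i,k}>0$ be a constant such that $h_i(v)\le h_i(u)+\langle R_{i,k}^{-1}\nabla h_i(u),v-u\rangle_{i,k}+\frac{L_{i,k}}2(d_i^k(v,u))^2$ for all $u,v\in\mathbb R^{d_i}$; choose $s_i^k>L_{i,k}$, $\gamma_i^k>1$, $\sigma_i^k=1/(\gamma_i^ks_i^k)$; and choose $$x_i^{k+1}\in\arg\min_{x}\Big[F_i(x)+\tfrac1{2\sigma_i^k}(d_i^k(x,y_i^k))^2+\langle R_{i,k}^{-1}\nabla h_i(y_i^k),x-y_i^k\rangle_{i,k}\Big].$$ (3) If $J(x^{k+1}_{(N)})>J(x^k_{(N)})-\rho_1\sum_i(d_i^k(x_i^{k+1},x_i^k))^2$, set $\beta^k=0$ and redo (1)–(2) once (so that $y_i^k=x_i^k$); the result of this second pass is the final $x^{k+1}_{(N)}$. (4) $t_{k+1}=\frac{1+\sqrt{1+4t_k^2}}2$, $\beta^{k+1}=t_k/t_{k+1}$. All quantities with index $k$ refer to the pass that produced the final $x_{(N)}^{k+1}$. GGBPL algorithm. Same input point $x^1_{(N)}=x^0_{(N)}\in\mathrm{dom}\,J$; for $k=1,2,\dots$ perform only step (2) with $y_i^k=x_i^k$ for all $i$ (no inertia, no test), under the same step-size conditions. *)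

theory Defs
  imports "HOL-Analysis.Analysis" "HOL-Library.Landau_Symbols"
begin

section \<open>Blocks\<close>

text \<open>
  The product of the spaces \<open>R^{d_1}, ..., R^{d_N}\<close>, with arbitrary and possibly different
  dimensions, is \<open>real ^ 'n\<close> together with a map \<open>b\<close> that sends each coordinate to the index
  (in \<open>{1..N}\<close>) of the block it belongs to, so that \<open>d_i\<close> is the number of coordinates sent
  to \<open>i\<close>. The factor \<open>R^{d_i}\<close> is identified isometrically with the coordinate subspace
  \<open>block b i\<close>, and the component \<open>x_i\<close> of \<open>x\<close> with \<open>proj b i x\<close>. A function on \<open>R^{d_i}\<close> is
  a function on \<open>real ^ 'n\<close> of which only the values on \<open>block b i\<close> are used.
\<close>

definition block :: "('n::finite \<Rightarrow> nat) \<Rightarrow> nat \<Rightarrow> (real ^ 'n) set" where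
  "block b i = {x. \<forall>j. b j \<noteq> i \<longrightarrow> x $ j = 0}"

definition proj :: "('n::finite \<Rightarrow> nat) \<Rightarrow> nat \<Rightarrow> real ^ 'n \<Rightarrow> real ^ 'n" where
  "proj b i x = (\<chi> j. if b j = i then x $ j else 0)"

definition with_block :: "('n::finite \<Rightarrow> nat) \<Rightarrow> nat \<Rightarrow> real ^ 'n \<Rightarrow> real ^ 'n \<Rightarrow> real ^ 'n" where
  "with_block b i c w = (\<chi> j. if b j = i then c $ j else w $ j)"

text \<open>\<open>mixed b i x' x\<close> has blocks \<open>x'_1, ..., x'_{i-1}, x_i, ..., x_N\<close>.\<close>

definition mixed :: "('n::finite \<Rightarrow> nat) \<Rightarrow> nat \<Rightarrow> real ^ 'n \<Rightarrow> real ^ 'n \<Rightarrow> real ^ 'n" where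
  "mixed b i x' x = (\<chi> j. if b j < i then x' $ j else x $ j)"

section \<open>Analytic notions\<close>

definition grad :: "('a::real_inner \<Rightarrow> real) \<Rightarrow> 'a \<Rightarrow> 'a" where
  "grad f x = (THE D. GDERIV f x :> D)"

definition proper_on :: "'a set \<Rightarrow> ('a \<Rightarrow> ereal) \<Rightarrow> bool" where
  "proper_on V f \<longleftrightarrow> (\<forall>x\<in>V. f x \<noteq> -\<infinity>) \<and> (\<exists>x\<in>V. f x < \<infinity>)"

definition lsc_on :: "'a::topological_space set \<Rightarrow> ('a \<Rightarrow> ereal) \<Rightarrow> bool" where
  "lsc_on V f \<longleftrightarrow> (\<forall>x\<in>V. f x \<le> Liminf (at x within V) f)"

definition bdd_below_on :: "'a set \<Rightarrow> ('a \<Rightarrow> ereal) \<Rightarrow> bool" where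
  "bdd_below_on V f \<longleftrightarrow> (\<exists>m::real. \<forall>x\<in>V. ereal m \<le> f x)"

definition norm_on :: "'a::real_vector set \<Rightarrow> ('a \<Rightarrow> real) \<Rightarrow> bool" where
  "norm_on V \<nu> \<longleftrightarrow>
     (\<forall>x\<in>V. 0 \<le> \<nu> x \<and> (\<nu> x = 0 \<longleftrightarrow> x = 0)) \<and>
     (\<forall>x\<in>V. \<forall>c. \<nu> (c *\<^sub>R x) = \<bar>c\<bar> * \<nu> x) \<and>
     (\<forall>x\<in>V. \<forall>y\<in>V. \<nu> (x + y) \<le> \<nu> x + \<nu> y)"

definition spd_on :: "'a::real_inner set \<Rightarrow> ('a \<Rightarrow> 'a) \<Rightarrow> bool" where
  "spd_on V R \<longleftrightarrow> linear R \<and> R ` V \<subseteq> V \<and>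
     (\<forall>u\<in>V. \<forall>v\<in>V. R u \<bullet> v = u \<bullet> R v) \<and> (\<forall>u\<in>V. u \<noteq> 0 \<longrightarrow> 0 < R u \<bullet> u)"

text \<open>
  The distance to a set is extended-real valued, so that the distance to the empty set is
  \<open>\<infinity>\<close> (whereas \<^const>\<open>infdist\<close> would give \<open>0\<close>).
\<close>

definition edist :: "'a::metric_space \<Rightarrow> 'a set \<Rightarrow> ereal" where
  "edist x S = (INF y\<in>S. ereal (dist x y))"

definition frechet_subdiff :: "('a::real_inner \<Rightarrow> ereal) \<Rightarrow> 'a \<Rightarrow> 'a set" where
  "frechet_subdiff f x = {u. f x < \<infinity> \<and>
     0 \<le> Liminf (at x) (\<lambda>y. (f y - f x - ereal (u \<bullet> (y - x))) / ereal (norm (y - x)))}"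

definition lim_subdiff :: "('a::real_inner \<Rightarrow> ereal) \<Rightarrow> 'a \<Rightarrow> 'a set" where
  "lim_subdiff f x = {u. \<exists>xs us. xs \<longlonglongrightarrow> x \<and> (\<lambda>k. f (xs k)) \<longlonglongrightarrow> f x \<and>
     (\<forall>k::nat. us k \<in> frechet_subdiff f (xs k)) \<and> us \<longlonglongrightarrow> u}"

definition desingularization :: "ereal \<Rightarrow> (real \<Rightarrow> real) \<Rightarrow> bool" where
  "desingularization \<eta> \<phi> \<longleftrightarrow>
     concave_on {t. 0 \<le> t \<and> ereal t < \<eta>} \<phi> \<and>
     continuous_on {t. 0 \<le> t \<and> ereal t < \<eta>} \<phi> \<and>
     \<phi> 0 = 0 \<and> (\<forall>t. 0 \<le> t \<and> ereal t < \<eta> \<longrightarrow> 0 \<le> \<phi> t) \<and>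
     (\<forall>t. 0 < t \<and> ereal t < \<eta> \<longrightarrow> \<phi> differentiable at t \<and> 0 < deriv \<phi> t) \<and>
     continuous_on {t. 0 < t \<and> ereal t < \<eta>} (deriv \<phi>)"

definition KL_function :: "('a::real_inner \<Rightarrow> ereal) \<Rightarrow> bool" where
  "KL_function f \<longleftrightarrow> (\<forall>ubar. lim_subdiff f ubar \<noteq> {} \<longrightarrow>
     (\<exists>\<eta> U \<phi>. 0 < \<eta> \<and> open U \<and> ubar \<in> U \<and> desingularization \<eta> \<phi> \<and>
       (\<forall>u\<in>U. f ubar < f u \<and> f u < f ubar + \<eta> \<longrightarrow>
          1 \<le> ereal (deriv \<phi> (real_of_ereal (f u - f ubar))) * edist 0 (lim_subdiff f u))))"

section \<open>The problem and the standing assumptions\<close>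

definition objective ::
  "nat \<Rightarrow> ('n::finite \<Rightarrow> nat) \<Rightarrow> (real ^ 'n \<Rightarrow> real) \<Rightarrow> (nat \<Rightarrow> real ^ 'n \<Rightarrow> ereal) \<Rightarrow> real ^ 'n \<Rightarrow> ereal"
  where "objective N b H F x = ereal (H x) + (\<Sum>i=1..N. F i (proj b i x))"

definition smooth_coupling :: "nat \<Rightarrow> ('n::finite \<Rightarrow> nat) \<Rightarrow> (real ^ 'n \<Rightarrow> real) \<Rightarrow> bool" where
  "smooth_coupling N b H \<longleftrightarrow>
     (\<forall>x. \<exists>D. GDERIV H x :> D) \<and> continuous_on UNIV (grad H) \<and>
     (\<forall>i\<in>{1..N}. \<forall>w. \<exists>L. L-lipschitz_on (block b i) (grad (\<lambda>c. H (with_block b i c w)))) \<and>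
     (\<forall>S. bounded S \<longrightarrow> (\<exists>L. L-lipschitz_on S (grad H)))"

definition admissible_terms ::
  "nat \<Rightarrow> ('n::finite \<Rightarrow> nat) \<Rightarrow> (nat \<Rightarrow> real ^ 'n \<Rightarrow> ereal) \<Rightarrow> bool" where
  "admissible_terms N b F \<longleftrightarrow> (\<forall>i\<in>{1..N}.
     proper_on (block b i) (F i) \<and> lsc_on (block b i) (F i) \<and> bdd_below_on (block b i) (F i))"

definition admissible_objective :: "('a::real_inner \<Rightarrow> ereal) \<Rightarrow> bool" where
  "admissible_objective J \<longleftrightarrow>
     KL_function J \<and> proper_on UNIV J \<and> (J \<longlongrightarrow> \<infinity>) at_infinity \<and> bdd_below_on UNIV J"

definition admissible_metrics ::
  "nat \<Rightarrow> ('n::finite \<Rightarrow> nat) \<Rightarrow> (nat \<Rightarrow> (real ^ 'n \<Rightarrow> real ^ 'n \<Rightarrow> real) set) \<Rightarrow> bool" where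
  "admissible_metrics N b D \<longleftrightarrow> (\<forall>i\<in>{1..N}.
     (\<forall>d\<in>D i. Metric_space (block b i) d) \<and>
     (\<exists>\<nu> C. norm_on (block b i) \<nu> \<and> 0 < C \<and>
        (\<forall>d\<in>D i. \<forall>x\<in>block b i. \<forall>y\<in>block b i. C * \<nu> (x - y) \<le> d x y)) \<and>
     (\<forall>d\<in>D i. \<forall>y\<in>block b i. convex_on (block b i) (\<lambda>x. d x y)) \<and>
     (\<forall>K. compact K \<and> K \<subseteq> block b i \<times> block b i \<longrightarrow>
        (\<exists>M::real. \<forall>(x, y)\<in>K. (SUP d\<in>D i. ereal (d x y)) \<le> ereal M)))"

section \<open>The algorithms\<close>

text \<open>
  The choices made in the update of one block: the operator \<open>R\<close>, the metric \<open>d\<close>, the constant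
  \<open>L\<close>, and the parameters \<open>s\<close> and \<open>\<gamma>\<close>.
\<close>

record 'v choices =
  op_R :: "'v \<Rightarrow> 'v"
  met_d :: "'v \<Rightarrow> 'v \<Rightarrow> real"
  con_L :: real
  par_s :: real
  par_\<gamma> :: real

definition step_\<sigma> :: "'v choices \<Rightarrow> real" where
  "step_\<sigma> p = 1 / (par_\<gamma> p * par_s p)"

text \<open>
  Update of block \<open>i\<close>: \<open>x\<close> is the current iterate, \<open>y\<close> the extrapolated point, and \<open>x'\<close> the next
  iterate. The function \<open>h\<close> depends only on block \<open>i\<close> of its argument, so \<open>grad h u\<close> lies in
  \<open>block b i\<close> and is the gradient of \<open>h\<close> as a function on \<open>R^{d_i}\<close>; \<open>G\<close> is its image under
  the inverse of \<open>R\<close>.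
\<close>

definition block_update ::
  "('n::finite \<Rightarrow> nat) \<Rightarrow> (real ^ 'n \<Rightarrow> real) \<Rightarrow> (nat \<Rightarrow> real ^ 'n \<Rightarrow> ereal) \<Rightarrow>
   (nat \<Rightarrow> (real ^ 'n \<Rightarrow> real ^ 'n \<Rightarrow> real) set) \<Rightarrow>
   nat \<Rightarrow> (real ^ 'n) choices \<Rightarrow> real ^ 'n \<Rightarrow> real ^ 'n \<Rightarrow> real ^ 'n \<Rightarrow> bool" where
  "block_update b H F D i p y x x' \<longleftrightarrow>
    (let V = block b i;
         h = (\<lambda>c. H (with_block b i c (mixed b i x' x)));
         ip = (\<lambda>u v. op_R p u \<bullet> v);
         G = (\<lambda>u. inv_into V (op_R p) (grad h u))
     in spd_on V (op_R p) \<and> met_d p \<in> D i \<and>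
        0 < con_L p \<and>
        (\<forall>u\<in>V. \<forall>v\<in>V. h v \<le> h u + ip (G u) (v - u) + con_L p / 2 * (met_d p v u)\<^sup>2) \<and>
        con_L p < par_s p \<and> 1 < par_\<gamma> p \<and>
        is_arg_min
          (\<lambda>c. F i c + ereal (1 / (2 * step_\<sigma> p) * (met_d p c (proj b i y))\<^sup>2
                              + ip (G (proj b i y)) (c - proj b i y)))
          (\<lambda>c. c \<in> V) (proj b i x'))"

definition bpl_pass ::
  "nat \<Rightarrow> ('n::finite \<Rightarrow> nat) \<Rightarrow> (real ^ 'n \<Rightarrow> real) \<Rightarrow> (nat \<Rightarrow> real ^ 'n \<Rightarrow> ereal) \<Rightarrow>
   (nat \<Rightarrow> (real ^ 'n \<Rightarrow> real ^ 'n \<Rightarrow> real) set) \<Rightarrow>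
   (nat \<Rightarrow> (real ^ 'n) choices) \<Rightarrow> real ^ 'n \<Rightarrow> real ^ 'n \<Rightarrow> real ^ 'n \<Rightarrow> bool" where
  "bpl_pass N b H F D P y x x' \<longleftrightarrow> (\<forall>i\<in>{1..N}. block_update b H F D i (P i) y x x')"

text \<open>
  The extrapolation parameters: starting the recursion for \<open>t\<close> at \<open>t_0 = 0\<close> gives
  \<open>t_1 = 1\<close> and makes \<open>\<beta>^k = t_{k-1} / t_k\<close> valid for \<open>k = 1\<close> as well, with \<open>\<beta>^1 = 0\<close>.
\<close>

primrec tseq :: "nat \<Rightarrow> real" where
  "tseq 0 = 0"
| "tseq (Suc k) = (1 + sqrt (1 + 4 * (tseq k)\<^sup>2)) / 2"

definition inertia :: "nat \<Rightarrow> real" where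
  "inertia k = tseq (k - 1) / tseq k"

lemma tseq_1: "tseq 1 = 1"
  by simp

lemma inertia_1: "inertia 1 = 0"
  by (simp add: inertia_def)

text \<open>The inequality that triggers the second pass.\<close>

definition insufficient_decrease ::
  "nat \<Rightarrow> ('n::finite \<Rightarrow> nat) \<Rightarrow> (real ^ 'n \<Rightarrow> ereal) \<Rightarrow> real \<Rightarrow>
   (nat \<Rightarrow> (real ^ 'n) choices) \<Rightarrow> real ^ 'n \<Rightarrow> real ^ 'n \<Rightarrow> bool" where
  "insufficient_decrease N b J \<rho> P x x' \<longleftrightarrow>
     J x' > J x - ereal (\<rho> * (\<Sum>i=1..N. (met_d (P i) (proj b i x') (proj b i x))\<^sup>2))"

text \<open>
  In both algorithms \<open>P k i\<close> collects the choices for block \<open>i\<close> in the pass that produced the final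
  iterate \<open>z (k + 1)\<close>. In the inertial one, \<open>Q\<close> and \<open>x'\<close> are the choices and the result of a
  discarded first pass.
\<close>

definition iGGBPL ::
  "nat \<Rightarrow> ('n::finite \<Rightarrow> nat) \<Rightarrow> (real ^ 'n \<Rightarrow> real) \<Rightarrow> (nat \<Rightarrow> real ^ 'n \<Rightarrow> ereal) \<Rightarrow>
   (nat \<Rightarrow> (real ^ 'n \<Rightarrow> real ^ 'n \<Rightarrow> real) set) \<Rightarrow> real \<Rightarrow>
   (nat \<Rightarrow> nat \<Rightarrow> (real ^ 'n) choices) \<Rightarrow> (nat \<Rightarrow> real ^ 'n) \<Rightarrow> bool" where
  "iGGBPL N b H F D \<rho> P z \<longleftrightarrow>
     z 1 = z 0 \<and> objective N b H F (z 1) < \<infinity> \<and>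
     (\<forall>k\<ge>1. let J = objective N b H F; y = z k + inertia k *\<^sub>R (z k - z (k - 1)) in
        (bpl_pass N b H F D (P k) y (z k) (z (k + 1)) \<and>
         \<not> insufficient_decrease N b J \<rho> (P k) (z k) (z (k + 1))) \<or>
        (\<exists>Q x'. bpl_pass N b H F D Q y (z k) x' \<and>
                insufficient_decrease N b J \<rho> Q (z k) x' \<and>
                bpl_pass N b H F D (P k) (z k) (z k) (z (k + 1))))"

definition GGBPL ::
  "nat \<Rightarrow> ('n::finite \<Rightarrow> nat) \<Rightarrow> (real ^ 'n \<Rightarrow> real) \<Rightarrow> (nat \<Rightarrow> real ^ 'n \<Rightarrow> ereal) \<Rightarrow>
   (nat \<Rightarrow> (real ^ 'n \<Rightarrow> real ^ 'n \<Rightarrow> real) set) \<Rightarrow>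
   (nat \<Rightarrow> nat \<Rightarrow> (real ^ 'n) choices) \<Rightarrow> (nat \<Rightarrow> real ^ 'n) \<Rightarrow> bool" where
  "GGBPL N b H F D P z \<longleftrightarrow>
     z 1 = z 0 \<and> objective N b H F (z 1) < \<infinity> \<and>
     (\<forall>k\<ge>1. bpl_pass N b H F D (P k) (z k) (z k) (z (k + 1)))"

text \<open>
  Both infima are of sets of positive reals, as \<open>\<gamma> > 1\<close> and \<open>s > L > 0\<close> along the algorithms.
\<close>

definition step_size_conditions :: "nat \<Rightarrow> (nat \<Rightarrow> nat \<Rightarrow> 'v choices) \<Rightarrow> bool" where
  "step_size_conditions N P \<longleftrightarrow>
     0 < (INF (i, k)\<in>{1..N} \<times> {1..}. (par_\<gamma> (P k i) - 1) * par_s (P k i)) \<and>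
     0 < (INF (i, k)\<in>{1..N} \<times> {1..}. step_\<sigma> (P k i))"

text \<open>
  The assertions about the sequence \<open>z\<close>. The limit of the values is asserted to exist, and so are
  the least indices whose growth is estimated.
\<close>

definition iteration_complexity :: "('a::real_inner \<Rightarrow> ereal) \<Rightarrow> (nat \<Rightarrow> 'a) \<Rightarrow> bool" where
  "iteration_complexity J z \<longleftrightarrow>
    (let \<Delta> = (\<lambda>k. edist 0 (lim_subdiff J (z (k + 1)))) in
     (\<exists>Jstar::real. (\<lambda>k. J (z k)) \<longlonglongrightarrow> ereal Jstar \<and>
       (\<exists>C>0. \<forall>K\<ge>1.
          (MIN k\<in>{1..K}. (\<Delta> k)\<^sup>2) \<le> ereal C * (J (z 1) - ereal Jstar) / ereal (real K))) \<and>
     (\<forall>\<epsilon>>0. \<exists>k\<ge>1. (\<Delta> k)\<^sup>2 \<le> ereal \<epsilon>) \<and>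
     (\<lambda>\<epsilon>. real (LEAST k. 1 \<le> k \<and> (\<Delta> k)\<^sup>2 \<le> ereal \<epsilon>)) \<in> O[at_right 0](\<lambda>\<epsilon>. 1 / \<epsilon>) \<and>
     (\<forall>\<epsilon>>0. \<exists>k\<ge>1. \<Delta> k \<le> ereal \<epsilon>) \<and>
     (\<lambda>\<epsilon>. real (LEAST k. 1 \<le> k \<and> \<Delta> k \<le> ereal \<epsilon>)) \<in> O[at_right 0](\<lambda>\<epsilon>. 1 / \<epsilon>\<^sup>2))"

end

theory Submission
  imports Defs
begin

text \<open>
  Write \<open>e k = J (z k) - J (z (k + 1))\<close>. Both algorithms decrease \<open>J\<close> in each step by a multiple of
  the sum of the squared metric distances between the blocks of \<open>z k\<close> and \<open>z (k + 1)\<close>: in the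
  inertial algorithm by the acceptance test, otherwise because the proximal term outweighs the
  quadratic upper bound on the smooth part. Conversely, each new iterate minimises the nonsmooth part
  plus a finite convex function. The metrics being uniformly bounded on compact sets, convexity makes
  this function Lipschitz near the iterate with a constant proportional to the distances to the
  extrapolated point, and so \<open>J\<close> has a small downward slope there. A point where the downward slope is
  at most \<open>l\<close> has a limiting subgradient of norm at most \<open>l\<close>: minimise \<open>J\<close> plus a smoothing of the
  cone \<open>l * norm (x - z)\<close>. Since extrapolation reaches back one step, the squared subgradient norm at
  \<open>z (k + 1)\<close> is bounded by a multiple of \<open>e (k - 1) + e k\<close>. These terms telescope, and the minimum
  is at most the average.
\<close>

section \<open>Lower semicontinuity and slopes\<close>

text \<open>The \<open>Liminf\<close> ignores the centre, but there the strict inequality is the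
  hypothesis itself. With \<open>nhds\<close> in place of \<open>at\<close>, the property can be
  pulled back along maps that are not injective.\<close>

lemma lsc_on_eventually_nhds:
  assumes "lsc_on V f" "x \<in> V" "C < f x"
  shows "\<forall>\<^sub>F y in nhds x. y \<in> V \<longrightarrow> C < f y"
proof -
  have "\<forall>\<^sub>F y in at x within V. C < f y"
    using assms by (auto simp: lsc_on_def le_Liminf_iff)
  then show ?thesis
    using assms(3) by (auto simp: eventually_at_filter elim: eventually_mono)
qed

lemma lsc_on_UNIV_I:
  assumes "\<And>x C. C < f x \<Longrightarrow> \<forall>\<^sub>F y in nhds x. C < f y"
  shows "lsc_on UNIV f"
  unfolding lsc_on_def le_Liminf_iff
proof (intro ballI allI impI)
  fix x C assume "C < f x"
  then show "\<forall>\<^sub>F y in at x. C < f y"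
    using assms[of C x] by (simp add: eventually_nhds_conv_at)
qed

text \<open>Below a finite sum the slack is shared equally; if one summand is infinite, its bound
  can be raised to make up for the other. Excluding \<open>-\<infinity>\<close> leaves room below
  each summand.\<close>

lemma ereal_less_add_split:
  fixes a b :: ereal
  assumes "C < a + b" "a \<noteq> -\<infinity>" "b \<noteq> -\<infinity>"
  obtains c d where "c < a" "d < b" "C \<le> c + d"
proof (cases C)
  case MInf
  have "-\<infinity> < a" "-\<infinity> < b" using assms by auto
  then show ?thesis using MInf that by (metis ereal_infty_less_eq(2) bot_ereal_def bot_least)
next
  case (real r)
  consider (both) a' b' where "a = ereal a'" "b = ereal b'" | (a) "a = \<infinity>" | (b) "b = \<infinity>"
    using assms by (cases a; cases b) auto
  then show ?thesis
  proof cases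
    case both
    define e where "e = (a' + b' - r) / 2"
    have "e > 0" using assms both real by (simp add: e_def)
    then show ?thesis using both real by (intro that[of "ereal (a' - e)" "ereal (b' - e)"])
      (auto simp: e_def field_simps)
  next
    case a
    obtain d where "d < b" "-\<infinity> < d" using assms(3) dense[of "-\<infinity>" b] by auto
    moreover then obtain d' where "d = ereal d'" by (cases d) auto
    ultimately show ?thesis using a real by (intro that[of "ereal (r - d')" d]) auto
  next
    case b
    obtain d where "d < a" "-\<infinity> < d" using assms(2) dense[of "-\<infinity>" a] by auto
    moreover then obtain d' where "d = ereal d'" by (cases d) auto
    ultimately show ?thesis using b real by (intro that[of d "ereal (r - d')"]) auto
  qed
next
  case PInf then show ?thesis using assms by auto
qed

lemma lsc_on_add:
  fixes f g :: "'a::topological_space \<Rightarrow> ereal"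
  assumes f: "lsc_on UNIV f" and g: "lsc_on UNIV g"
    and inf: "\<And>x. f x \<noteq> -\<infinity>" "\<And>x. g x \<noteq> -\<infinity>"
  shows "lsc_on UNIV (\<lambda>x. f x + g x)"
proof (rule lsc_on_UNIV_I)
  fix x C assume C: "C < f x + g x"
  obtain c d where cd: "c < f x" "d < g x" "C \<le> c + d"
    using ereal_less_add_split[OF C inf] by blast
  have "\<forall>\<^sub>F y in nhds x. c < f y" "\<forall>\<^sub>F y in nhds x. d < g y"
    using lsc_on_eventually_nhds[OF f] lsc_on_eventually_nhds[OF g] cd by auto
  then show "\<forall>\<^sub>F y in nhds x. C < f y + g y"
  proof eventually_elim
    case (elim y)
    have "c + d < f y + g y" using elim by (rule ereal_add_strict_mono2)
    then show ?case using cd by auto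
  qed
qed

lemma sum_ereal_neq_MInf:
  fixes f :: "'i \<Rightarrow> ereal"
  assumes "\<And>i. i \<in> I \<Longrightarrow> f i \<noteq> -\<infinity>"
  shows "(\<Sum>i\<in>I. f i) \<noteq> -\<infinity>"
  using assms by (induction I rule: infinite_finite_induct) auto

lemma lsc_on_sum:
  fixes f :: "'i \<Rightarrow> 'a::topological_space \<Rightarrow> ereal"
  assumes "finite I" "\<And>i. i \<in> I \<Longrightarrow> lsc_on UNIV (f i)" "\<And>i x. i \<in> I \<Longrightarrow> f i x \<noteq> -\<infinity>"
  shows "lsc_on UNIV (\<lambda>x. \<Sum>i\<in>I. f i x)"
  using assms
proof (induction I rule: finite_induct)
  case empty
  then show ?case by (intro lsc_on_UNIV_I) simp
next
  case (insert i I)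
  have "(\<Sum>i\<in>I. f i x) \<noteq> -\<infinity>" for x
    using insert by (intro sum_ereal_neq_MInf) auto
  then show ?case using insert by (simp add: lsc_on_add)
qed

lemma lsc_on_ereal_continuous:
  fixes h :: "'a::t2_space \<Rightarrow> real"
  assumes "continuous_on UNIV h"
  shows "lsc_on UNIV (\<lambda>x. ereal (h x))"
proof (rule lsc_on_UNIV_I)
  fix x and C :: ereal
  have "isCont h x"
    using assms by (simp add: continuous_on_eq_continuous_at)
  then have "filterlim (\<lambda>x. ereal (h x)) (nhds (ereal (h x))) (nhds x)"
    by (intro tendsto_ereal) (simp add: isCont_def tendsto_at_iff_tendsto_nhds)
  moreover assume "C < ereal (h x)"
  ultimately show "\<forall>\<^sub>F y in nhds x. C < ereal (h y)" by (rule order_tendstoD(1))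
qed

text \<open>The terms \<open>F i\<close> are controlled on their blocks only; composing with a
  projection makes them lower semicontinuous on the whole space, where the objective lives.\<close>

lemma lsc_on_compose:
  fixes p :: "'a::t2_space \<Rightarrow> 'b::topological_space"
  assumes f: "lsc_on V f" and p: "continuous_on UNIV p" "range p \<subseteq> V"
  shows "lsc_on UNIV (\<lambda>x. f (p x))"
proof (rule lsc_on_UNIV_I)
  fix x C assume "C < f (p x)"
  then have "\<forall>\<^sub>F y in nhds (p x). y \<in> V \<longrightarrow> C < f y"
    using lsc_on_eventually_nhds[OF f, of "p x" C] p by (simp add: range_subsetD)
  moreover have "filterlim p (nhds (p x)) (nhds x)"
    using p by (simp add: continuous_on_eq_continuous_at isCont_def tendsto_at_iff_tendsto_nhds)
  ultimately have "\<forall>\<^sub>F y in nhds x. p y \<in> V \<longrightarrow> C < f (p y)"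
    by (auto simp: filterlim_iff)
  then show "\<forall>\<^sub>F y in nhds x. C < f (p y)" using p by (auto elim!: eventually_mono)
qed

text \<open>Without a minimiser every \<open>x\<close> in \<open>K\<close> has a strictly better
  \<open>g x\<close>, and \<open>f\<close> still exceeds \<open>f (g x)\<close> on a neighbourhood
  of \<open>x\<close>. For a finite subcover, the best of the finitely many \<open>g t\<close> lies
  in some \<open>U x\<close>, so \<open>g x\<close> would be better still.\<close>

lemma lsc_on_attains_inf:
  fixes f :: "'a::topological_space \<Rightarrow> ereal"
  assumes K: "compact K" "K \<noteq> {}" and f: "lsc_on UNIV f"
  obtains x where "x \<in> K" "\<And>y. y \<in> K \<Longrightarrow> f x \<le> f y"
proof (rule ccontr)
  assume "\<not> thesis"
  then have "\<forall>x\<in>K. \<exists>y\<in>K. f y < f x" using that by (meson not_le)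
  then obtain g where g: "\<And>x. x \<in> K \<Longrightarrow> g x \<in> K \<and> f (g x) < f x" by metis
  have "\<forall>x\<in>K. \<exists>U. open U \<and> x \<in> U \<and> (\<forall>y\<in>U. f (g x) < f y)"
    using lsc_on_eventually_nhds[OF f] g by (auto simp: eventually_nhds)
  then obtain U where U: "\<And>x. x \<in> K \<Longrightarrow> open (U x) \<and> x \<in> U x \<and> (\<forall>y\<in>U x. f (g x) < f y)"
    by metis
  obtain T where T: "T \<subseteq> K" "finite T" "K \<subseteq> (\<Union>x\<in>T. U x)"
    using compactE_image[OF K(1), of K U] U by blast
  have "T \<noteq> {}" using K T by auto
  define t where "t = arg_min_on (f \<circ> g) T"
  have t: "t \<in> T" "\<And>x. x \<in> T \<Longrightarrow> f (g t) \<le> f (g x)"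
    using arg_min_if_finite(1)[OF T(2) \<open>T \<noteq> {}\<close>, of "f \<circ> g"]
      arg_min_least[OF T(2) \<open>T \<noteq> {}\<close>, of _ "f \<circ> g"] by (auto simp: t_def)
  obtain x where "x \<in> T" "g t \<in> U x" using g t T by blast
  then have "f (g x) < f (g t)" using U T by blast
  then show False using t \<open>x \<in> T\<close> by (auto simp: not_le[symmetric])
qed

section \<open>From downward slopes to limiting subgradients\<close>

lemma frechet_subdiff_local_min:
  fixes f :: "'a::euclidean_space \<Rightarrow> ereal"
  assumes fx: "f x = ereal c" and \<theta>: "GDERIV \<theta> x :> v"
    and min: "\<forall>\<^sub>F y in nhds x. f x + ereal (\<theta> x) \<le> f y + ereal (\<theta> y)"
  shows "- v \<in> frechet_subdiff f x"
proof -
  let ?q = "\<lambda>y. (\<theta> x - \<theta> y + v \<bullet> (y - x)) / norm (y - x)"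
  have "((\<lambda>y. (\<theta> y - \<theta> x - (y - x) \<bullet> v) /\<^sub>R norm (y - x)) \<longlongrightarrow> 0) (at x)"
    using \<theta> by (simp add: gderiv_def has_derivative_at_within)
  from tendsto_minus[OF this] have lim: "(?q \<longlongrightarrow> 0) (at x)"
    by (simp add: divide_inverse inner_commute algebra_simps)
  \<comment> \<open>Local minimality bounds the quotient of \<open>f\<close> for the candidate
    \<open>- v\<close> below by \<open>?q\<close>, which tends to 0 because it is minus the
    remainder quotient of \<open>\<theta>\<close>.\<close>
  have "0 = Liminf (at x) (\<lambda>y. ereal (?q y))"
    by (rule lim_imp_Liminf[symmetric]) (use lim in \<open>auto simp: zero_ereal_def\<close>)
  also have "\<dots> \<le> Liminf (at x) (\<lambda>y. (f y - f x - ereal (- v \<bullet> (y - x))) / ereal (norm (y - x)))"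
  proof (rule Liminf_mono)
    have "\<forall>\<^sub>F y in at x. f x + ereal (\<theta> x) \<le> f y + ereal (\<theta> y)"
      using min by (simp add: eventually_nhds_conv_at)
    moreover have "\<forall>\<^sub>F y in at x. y \<noteq> x" by (simp add: eventually_at_filter)
    ultimately show "\<forall>\<^sub>F y in at x. ereal (?q y) \<le> (f y - f x - ereal (- v \<bullet> (y - x))) / ereal (norm (y - x))"
    proof eventually_elim
      case (elim y)
      then show ?case using fx
        by (cases "f y") (auto simp: divide_right_mono)
    qed
  qed
  finally show ?thesis by (simp add: frechet_subdiff_def fx)
qed

text \<open>Comparing the perturbed minimiser \<open>x\<close> with \<open>z\<close> from both sides
  forces \<open>(norm (x - z))\<^sup>2 \<le> l * \<eta>\<close>: minimality gives the upper
  estimate, the slope condition the lower one, and the terms \<open>l * norm (x - z)\<close> cancel.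
  So \<open>x\<close> is interior to the ball and the first-order condition applies.\<close>

lemma frechet_subgradient_near_slope:
  fixes f :: "'a::euclidean_space \<Rightarrow> ereal"
  assumes f: "lsc_on UNIV f" and ninf: "\<And>x. f x \<noteq> -\<infinity>"
    and fz: "f z = ereal a" and l: "0 \<le> l"
    and slope: "\<forall>\<^sub>F x in nhds z. f z \<le> f x + ereal (l * norm (x - z))" and \<delta>: "0 < \<delta>"
  obtains x u where "norm (x - z) < \<delta>" "\<bar>f x - f z\<bar> < ereal \<delta>"
    "u \<in> frechet_subdiff f x" "norm u \<le> l + \<delta>"
proof -
  obtain r0 where r0: "r0 > 0" "\<And>x. norm (x - z) < r0 \<Longrightarrow> f z \<le> f x + ereal (l * norm (x - z))"
    using slope by (auto simp: eventually_nhds_metric dist_norm)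
  \<comment> \<open>\<open>2 * r \<le> \<delta>\<close> bounds the gradient of the quadratic part of
    \<open>\<theta>\<close>, and \<open>l * r < \<delta>\<close> the drop of \<open>f\<close>.
    Dividing by \<open>1 + l\<close> admits \<open>l = 0\<close>, and the final halving makes
    \<open>r < r0\<close> strict.\<close>
  define r where "r = min r0 (\<delta> / (1 + l)) / 2"
  have r: "0 < r" "r < r0" using r0 l \<delta> by (auto simp: r_def)
  have "2 * r \<le> \<delta> / (1 + l)" by (simp add: r_def)
  then have "2 * (r * (1 + l)) \<le> \<delta>" using l by (simp add: field_simps)
  moreover have "0 \<le> r * l" using r l by simp
  ultimately have r2: "2 * r \<le> \<delta>" "l * r < \<delta>" using r by (auto simp: algebra_simps)
  \<comment> \<open>\<open>l * \<eta>\<close> is the value of \<open>\<theta>\<close> at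
    \<open>z\<close>. It must be below \<open>r\<^sup>2\<close> to keep the minimiser off the
    sphere, and below \<open>\<delta>\<close> to limit the excess of \<open>f x\<close> over
    \<open>f z\<close>.\<close>
  define \<eta> where "\<eta> = min (r\<^sup>2) \<delta> / (2 * (1 + l))"
  have \<eta>: "0 < \<eta>" using r l \<delta> by (simp add: \<eta>_def)
  have "0 \<le> l * \<eta>" using \<eta> l by simp
  then have "l * \<eta> < (1 + l) * \<eta> * 2" using \<eta> unfolding distrib_right mult_1 by linarith
  also have "\<dots> = min (r\<^sup>2) \<delta>" using l by (simp add: \<eta>_def divide_simps)
  finally have l\<eta>: "l * \<eta> < r\<^sup>2" "l * \<eta> < \<delta>" by auto
  \<comment> \<open>\<open>s\<close> smooths the cone \<open>norm (x - z)\<close>; the square makes the minimisers converge to \<open>z\<close>.\<close>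
  define s where "s = (\<lambda>x. sqrt ((x - z) \<bullet> (x - z) + \<eta>\<^sup>2))"
  define \<theta> where "\<theta> = (\<lambda>x. l * s x + (x - z) \<bullet> (x - z))"
  have s_ge: "norm (x - z) \<le> s x" for x
    by (simp add: s_def power2_norm_eq_inner[symmetric] real_le_rsqrt)
  have s_pos: "0 < s x" for x
    using \<eta> by (simp add: s_def add_nonneg_pos)
  have deriv: "GDERIV \<theta> x :> (l / s x) *\<^sub>R (x - z) + 2 *\<^sub>R (x - z)" for x
  proof -
    have sq: "GDERIV (\<lambda>x. (x - z) \<bullet> (x - z)) x :> 2 *\<^sub>R (x - z)"
      unfolding gderiv_def
      by (rule derivative_eq_intros refl)+ (simp add: fun_eq_iff inner_commute)
    have pos: "0 < (x - z) \<bullet> (x - z) + \<eta>\<^sup>2" using \<eta> by (simp add: add_nonneg_pos)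
    have "GDERIV s x :> (inverse (s x) / 2) *\<^sub>R (2 *\<^sub>R (x - z) + 0)"
      unfolding s_def
      by (rule GDERIV_DERIV_compose[OF GDERIV_add[OF sq GDERIV_const] DERIV_real_sqrt[OF pos]])
    from GDERIV_add[OF GDERIV_mult[OF GDERIV_const[of l x] this] sq]
    have "GDERIV \<theta> x :> l *\<^sub>R (inverse (s x) / 2) *\<^sub>R (2 *\<^sub>R (x - z) + 0) + s x *\<^sub>R 0 + 2 *\<^sub>R (x - z)"
      unfolding \<theta>_def .
    moreover have "l * (inverse (s x) / 2 * 2) = l / s x" by (simp add: inverse_eq_divide)
    ultimately show ?thesis
      by (simp only: scaleR_scaleR add_0_right scaleR_zero_right)
  qed
  have "continuous_on UNIV \<theta>" unfolding \<theta>_def s_def by (intro continuous_intros)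
  then have "lsc_on UNIV (\<lambda>x. f x + ereal (\<theta> x))"
    by (intro lsc_on_add f lsc_on_ereal_continuous ninf) auto
  then obtain x where x: "x \<in> cball z r"
    and min: "\<And>y. y \<in> cball z r \<Longrightarrow> f x + ereal (\<theta> x) \<le> f y + ereal (\<theta> y)"
    using lsc_on_attains_inf[OF compact_cball, of z r "\<lambda>x. f x + ereal (\<theta> x)"] r
    by (metis cball_eq_empty not_less_iff_gr_or_eq)
  have xr: "norm (x - z) \<le> r" using x by (simp add: dist_norm norm_minus_commute)
  have "\<theta> z = l * \<eta>" using \<eta> by (simp add: \<theta>_def s_def)
  then have le: "f x + ereal (\<theta> x) \<le> ereal (a + l * \<eta>)" using min[of z] r fz by simp
  then obtain c where c: "f x = ereal c" using ninf[of x] by (cases "f x") auto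
  have "l * norm (x - z) + (norm (x - z))\<^sup>2 \<le> \<theta> x"
    using s_ge[of x] l by (simp add: \<theta>_def power2_norm_eq_inner mult_left_mono)
  then have up: "c + l * norm (x - z) + (norm (x - z))\<^sup>2 \<le> a + l * \<eta>" using le c by simp
  have lo: "a \<le> c + l * norm (x - z)" using r0(2)[of x] xr r c fz by simp
  have "(norm (x - z))\<^sup>2 < r\<^sup>2" using up lo l\<eta> by linarith
  then have "norm (x - z) < r" using r by (simp add: power_less_imp_less_base)
  then have "x \<in> ball z r" by (simp add: dist_norm norm_minus_commute)
  then have "\<forall>\<^sub>F y in nhds x. y \<in> ball z r" by (rule eventually_nhds_in_open[OF open_ball])
  then have "\<forall>\<^sub>F y in nhds x. f x + ereal (\<theta> x) \<le> f y + ereal (\<theta> y)"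
    by eventually_elim (intro min, auto)
  from frechet_subdiff_local_min[OF c deriv this]
  have u: "- ((l / s x) *\<^sub>R (x - z) + 2 *\<^sub>R (x - z)) \<in> frechet_subdiff f x" .
  have "norm (- ((l / s x) *\<^sub>R (x - z) + 2 *\<^sub>R (x - z))) \<le> (l / s x) * norm (x - z) + 2 * norm (x - z)"
    using l s_pos[of x] norm_triangle_ineq[of "(l / s x) *\<^sub>R (x - z)" "2 *\<^sub>R (x - z)"]
    unfolding norm_minus_cancel norm_scaleR by simp
  also have "(l / s x) * norm (x - z) \<le> l"
    using l s_pos[of x] s_ge[of x] by (simp add: field_simps mult_left_mono)
  finally have nu: "norm (- ((l / s x) *\<^sub>R (x - z) + 2 *\<^sub>R (x - z))) \<le> l + \<delta>"
    using xr r2 by linarith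
  have "l * norm (x - z) \<le> l * r" using xr l by (simp add: mult_left_mono)
  moreover have "c \<le> a + l * \<eta>"
    using up l by (smt (verit) mult_nonneg_nonneg norm_ge_zero zero_le_power2)
  ultimately have "\<bar>c - a\<bar> < \<delta>" using lo l\<eta> r2 by linarith
  then show thesis using that[OF _ _ u nu] c fz xr r r2 by auto
qed

text \<open>Subgradients at points approaching \<open>z\<close> are bounded, so a subsequence
  converges, and its limit is a limiting subgradient of norm at most \<open>l\<close>. Allowing the
  slope to exceed \<open>l\<close> by any positive \<open>\<epsilon>\<close> leaves room for
  first-order remainders.\<close>

lemma edist_lim_subdiff_le_slope:
  fixes f :: "'a::euclidean_space \<Rightarrow> ereal"
  assumes f: "lsc_on UNIV f" and ninf: "\<And>x. f x \<noteq> -\<infinity>" and fz: "f z = ereal a" and l: "0 \<le> l"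
    and slope: "\<And>\<epsilon>. 0 < \<epsilon> \<Longrightarrow> \<forall>\<^sub>F x in nhds z. f z \<le> f x + ereal ((l + \<epsilon>) * norm (x - z))"
  shows "edist 0 (lim_subdiff f z) \<le> ereal l"
proof -
  define e where "e = (\<lambda>n. inverse (real (Suc n)) / 2)"
  have e: "0 < e n" for n by (simp add: e_def)
  have e0: "e \<longlonglongrightarrow> 0" unfolding e_def
    using tendsto_divide[OF LIMSEQ_inverse_real_of_nat tendsto_const, of 2] by simp
  have "\<exists>x u. norm (x - z) < e n \<and> \<bar>f x - f z\<bar> < ereal (e n) \<and>
    u \<in> frechet_subdiff f x \<and> norm u \<le> l + e n + e n" for n
    using frechet_subgradient_near_slope[OF f ninf fz _ slope[OF e[of n]] e[of n]] l e[of n]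
    by (metis add_increasing2 less_imp_le add_nonneg_nonneg)
  then obtain xs us where xu: "\<And>n. norm (xs n - z) < e n" "\<And>n. \<bar>f (xs n) - f z\<bar> < ereal (e n)"
    "\<And>n. us n \<in> frechet_subdiff f (xs n)" "\<And>n. norm (us n) \<le> l + e n + e n" by metis
  have "e n \<le> 1" for n by (simp add: e_def field_simps)
  then have "us n \<in> cball 0 (l + 2)" for n using xu(4)[of n] by (simp add: dist_norm) (smt (verit))
  then obtain u \<sigma> where \<sigma>: "strict_mono \<sigma>" "(us \<circ> \<sigma>) \<longlonglongrightarrow> u"
    using compact_cball[of "0::'a" "l + 2"] unfolding compact_def by metis
  have e\<sigma>: "(e \<circ> \<sigma>) \<longlonglongrightarrow> 0" by (rule LIMSEQ_subseq_LIMSEQ[OF e0 \<sigma>(1)])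
  have fin: "\<exists>c. f (xs n) = ereal c \<and> \<bar>c - a\<bar> < e n" for n
    using xu(2)[of n] fz by (cases "f (xs n)") auto
  then obtain c where c: "\<And>n. f (xs n) = ereal (c n)" "\<And>n. \<bar>c n - a\<bar> < e n" by metis
  have "(\<lambda>n. norm (xs (\<sigma> n) - z)) \<longlonglongrightarrow> 0"
    by (rule Lim_null_comparison[OF _ e\<sigma>]) (auto intro!: always_eventually less_imp_le xu(1))
  then have "(\<lambda>n. xs (\<sigma> n)) \<longlonglongrightarrow> z"
    using LIM_zero_iff tendsto_norm_zero_iff by blast
  moreover have "(\<lambda>n. c (\<sigma> n) - a) \<longlonglongrightarrow> 0"
    by (rule Lim_null_comparison[OF _ e\<sigma>]) (auto intro!: always_eventually less_imp_le c(2))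
  then have "(\<lambda>n. f (xs (\<sigma> n))) \<longlonglongrightarrow> f z"
    using LIM_zero_iff c fz by auto
  ultimately have "u \<in> lim_subdiff f z"
    unfolding lim_subdiff_def mem_Collect_eq using xu(3) \<sigma>(2)
    by (intro exI[of _ "\<lambda>n. xs (\<sigma> n)"] exI[of _ "us \<circ> \<sigma>"]) auto
  then have "edist 0 (lim_subdiff f z) \<le> ereal (norm u)"
    unfolding edist_def by (rule INF_lower2) simp
  also have "norm u \<le> l"
  proof (rule LIMSEQ_le[OF tendsto_norm[OF \<sigma>(2)]])
    show "(\<lambda>n. l + (e \<circ> \<sigma>) n + (e \<circ> \<sigma>) n) \<longlonglongrightarrow> l"
      using tendsto_add[OF tendsto_add[OF tendsto_const e\<sigma>] e\<sigma>, of l] by simp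
    show "\<exists>N. \<forall>n\<ge>N. norm ((us \<circ> \<sigma>) n) \<le> l + (e \<circ> \<sigma>) n + (e \<circ> \<sigma>) n"
      using xu(4) by simp
  qed
  finally show ?thesis by simp
qed

section \<open>Blocks and metrics\<close>

lemma linear_proj: "linear (proj b i)"
  by (rule linearI) (auto simp: proj_def vec_eq_iff)

lemma proj_in_block [simp]: "proj b i x \<in> block b i"
  by (simp add: proj_def block_def)

lemma proj_block: "x \<in> block b i \<Longrightarrow> proj b i x = x"
  by (auto simp: proj_def block_def vec_eq_iff)

lemma subspace_block: "subspace (block b i)"
  by (auto simp: subspace_def block_def)

lemma norm_coordinate_mask_le: "norm (\<chi> j. if Q j then x $ j else 0) \<le> norm (x :: real ^ 'n::finite)"
  by (rule norm_le_componentwise_cart) auto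

lemma norm_proj_le: "norm (proj b i x) \<le> norm x"
  unfolding proj_def by (rule norm_coordinate_mask_le)

lemma inner_proj: "proj b i x \<bullet> y = x \<bullet> proj b i y"
  by (auto simp: proj_def inner_vec_def intro: sum.cong)

lemma sum_proj:
  assumes "range b \<subseteq> {1..N}"
  shows "(\<Sum>i=1..N. proj b i x) = x"
  using assms by (auto simp: proj_def vec_eq_iff image_subset_iff)

lemma with_block_eq: "with_block b i c w = proj b i c + (w - proj b i w)"
  by (auto simp: with_block_def proj_def vec_eq_iff)

lemma mixed_with_block: "with_block b i (proj b i x) (mixed b i x' x) = mixed b i x' x"
  by (auto simp: with_block_def proj_def mixed_def vec_eq_iff)

text \<open>Completing block \<open>i\<close> moves the sweep on by one index; with the previous
  identity, this makes the changes of \<open>H\<close> over a pass telescope.\<close>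

lemma mixed_with_block': "with_block b i (proj b i x') (mixed b i x' x) = mixed b (Suc i) x' x"
  by (auto simp: with_block_def proj_def mixed_def vec_eq_iff)

text \<open>Blocks before \<open>i\<close> are already updated and cancel, block \<open>i\<close>
  contributes \<open>x' - y\<close>, and the later ones contribute \<open>x' - x\<close>; masking
  coordinates does not increase the norm.\<close>

lemma norm_diff_with_block_mixed_le:
  "norm (x' - with_block b i (proj b i y) (mixed b i x' x)) \<le> norm (x' - y) + norm (x' - x)"
proof -
  have "x' - with_block b i (proj b i y) (mixed b i x' x)
      = (\<chi> j. if b j = i then (x' - y) $ j else 0) + (\<chi> j. if b j > i then (x' - x) $ j else 0)"
    by (auto simp: with_block_def proj_def mixed_def vec_eq_iff)
  then show ?thesis
    using norm_triangle_mono[OF norm_coordinate_mask_le norm_coordinate_mask_le,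
        of "\<lambda>j. b j = i" "x' - y" "\<lambda>j. b j > i" "x' - x"] by (simp del: vector_minus_component)
qed

section \<open>Partial gradients and the inner products of the updates\<close>

lemma grad_eqI: "GDERIV f x :> D \<Longrightarrow> grad f x = D"
proof -
  assume D: "GDERIV f x :> D"
  have "D' = D" if "GDERIV f x :> D'" for D'
  proof -
    have "(\<lambda>h. h \<bullet> D') = (\<lambda>h. h \<bullet> D)"
      using has_derivative_unique D that unfolding gderiv_def by blast
    then show ?thesis by (metis inner_commute vector_eq_ldot)
  qed
  then show ?thesis unfolding grad_def using D by (intro the_equality)
qed

lemma GDERIV_grad:
  assumes "smooth_coupling N b H"
  shows "GDERIV H x :> grad H x"
  using assms grad_eqI unfolding smooth_coupling_def by metis

text \<open>The chain rule for an affine map whose derivative \<open>proj b i\<close> is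
  self-adjoint and therefore carries over to the gradient.\<close>

lemma grad_with_block:
  assumes "GDERIV H (with_block b i u w) :> D"
  shows "grad (\<lambda>c. H (with_block b i c w)) u = proj b i D"
proof (rule grad_eqI)
  have 1: "((\<lambda>c. with_block b i c w) has_derivative proj b i) (at u)"
    unfolding with_block_eq
    by (rule derivative_eq_intros refl linear_imp_has_derivative linear_proj)+ simp
  show "GDERIV (\<lambda>c. H (with_block b i c w)) u :> proj b i D"
    using has_derivative_compose[OF 1 assms[unfolded gderiv_def]]
    by (simp add: gderiv_def inner_proj)
qed

text \<open>Positive definiteness makes \<open>R\<close> injective on \<open>V\<close>, and a
  dimension count makes it onto \<open>V\<close>. Hence \<open>inv_into\<close> is a genuine inverse
  there, and the inner product given by \<open>R\<close> cancels it.\<close>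

lemma spd_on_inv_into:
  fixes R :: "'a::euclidean_space \<Rightarrow> 'a"
  assumes "spd_on V R" "subspace V" "g \<in> V"
  shows "R (inv_into V R g) = g"
proof -
  have R: "linear R" "R ` V \<subseteq> V" and pos: "\<And>u. u \<in> V \<Longrightarrow> u \<noteq> 0 \<Longrightarrow> 0 < R u \<bullet> u"
    using assms(1) by (auto simp: spd_on_def)
  have "u = 0" if "u \<in> V" "R u = 0" for u using pos[of u] that by fastforce
  then have inj: "inj_on R V" using linear_injective_on_subspace_0[OF R(1) assms(2)] by blast
  have "dim (R ` V) = dim V"
    using dim_image_eq[OF R(1)] inj assms(2) by (simp add: span_eq_iff[THEN iffD2])
  then have "R ` V = V"
    using subspace_dim_equal R assms(2) linear_subspace_image by (metis order_refl)
  then show ?thesis using assms(3) by (intro f_inv_into_f) simp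
qed

section \<open>Uniform constants for the metric families\<close>

lemma norm_on_ge_norm:
  fixes \<nu> :: "real ^ 'n::finite \<Rightarrow> real"
  assumes \<nu>: "norm_on (block b i) \<nu>"
  obtains c where "0 < c" "\<And>x. x \<in> block b i \<Longrightarrow> c * norm x \<le> \<nu> x"
proof -
  let ?V = "block b i" and ?S = "block b i \<inter> sphere 0 1"
  have sub: "x + y \<in> ?V" "a *\<^sub>R x \<in> ?V" "x - y \<in> ?V" "0 \<in> ?V" if "x \<in> ?V" "y \<in> ?V" for x y a
    using that by (simp_all add: block_def)
  have nn: "\<And>x. x \<in> ?V \<Longrightarrow> 0 \<le> \<nu> x" and z: "\<And>x. x \<in> ?V \<Longrightarrow> \<nu> x = 0 \<longleftrightarrow> x = 0"
    and hom: "\<And>x a. x \<in> ?V \<Longrightarrow> \<nu> (a *\<^sub>R x) = \<bar>a\<bar> * \<nu> x"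
    and tri: "\<And>x y. x \<in> ?V \<Longrightarrow> y \<in> ?V \<Longrightarrow> \<nu> (x + y) \<le> \<nu> x + \<nu> y"
    using \<nu> by (simp_all add: norm_on_def)
  \<comment> \<open>The unit vectors are projected first because \<open>\<nu>\<close> is a norm on
    the block only. The bound makes \<open>\<nu>\<close> Lipschitz, so it attains a positive minimum
    on the unit sphere of the block.\<close>
  define B where "B = (\<Sum>j\<in>UNIV. \<nu> (proj b i (axis j 1)))"
  have bound: "\<nu> x \<le> B * norm x" if x: "x \<in> ?V" for x
  proof -
    have "x = (\<Sum>j\<in>UNIV. x $ j *\<^sub>R axis j 1)" using basis_expansion[of x] unfolding scalar_mult_eq_scaleR by (rule sym)
    then have "x = proj b i (\<Sum>j\<in>UNIV. x $ j *\<^sub>R axis j 1)" using proj_block[OF x] by simp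
    also have "\<dots> = (\<Sum>j\<in>UNIV. x $ j *\<^sub>R proj b i (axis j 1))"
      by (simp add: linear_sum[OF linear_proj] linear_scale[OF linear_proj])
    finally have "\<nu> x = \<nu> (\<Sum>j\<in>UNIV. x $ j *\<^sub>R proj b i (axis j 1))" by simp
    also have "\<dots> \<le> (\<Sum>j\<in>UNIV. \<bar>x $ j\<bar> * \<nu> (proj b i (axis j 1)))" (is "_ \<le> ?s UNIV")
    proof -
      have "(\<Sum>j\<in>J. x $ j *\<^sub>R proj b i (axis j 1)) \<in> ?V \<and>
        \<nu> (\<Sum>j\<in>J. x $ j *\<^sub>R proj b i (axis j 1)) \<le> ?s J" if "finite J" for J
        using that
      proof (induction J)
        case empty
        then show ?case using z[of 0] sub(4)[OF x x] by auto
      next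
        case (insert j J)
        then show ?case
          using tri[of "x $ j *\<^sub>R proj b i (axis j 1)" "\<Sum>j\<in>J. x $ j *\<^sub>R proj b i (axis j 1)"]
          by (auto simp: sub hom)
      qed
      then show ?thesis by simp
    qed
    also have "\<dots> \<le> (\<Sum>j\<in>UNIV. norm x * \<nu> (proj b i (axis j 1)))"
      by (intro sum_mono mult_right_mono component_le_norm_cart nn) simp
    finally show ?thesis by (simp add: B_def sum_distrib_left mult.commute)
  qed
  have "\<nu> x - \<nu> y \<le> B * norm (x - y)" if "x \<in> ?V" "y \<in> ?V" for x y
    using tri[of "x - y" y] bound[of "x - y"] sub that by auto
  then have "\<bar>\<nu> x - \<nu> y\<bar> \<le> B * norm (x - y)" if "x \<in> ?V" "y \<in> ?V" for x y
    using that by (smt (verit) norm_minus_commute)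
  moreover have "0 \<le> B" unfolding B_def by (intro sum_nonneg nn) simp
  ultimately have "B-lipschitz_on ?V \<nu>" by (auto intro!: lipschitz_onI simp: dist_norm)
  then have cont: "continuous_on ?S \<nu>"
    by (meson Int_lower1 continuous_on_subset lipschitz_on_continuous_on)
  have comp: "compact ?S" by (simp add: closed_Int_compact closed_subspace subspace_block)
  show thesis
  proof (cases "?S = {}")
    \<comment> \<open>A block without coordinates is the zero space and has an empty sphere; any
      constant will do.\<close>
    case True
    have "x = 0" if "x \<in> ?V" for x
    proof (rule ccontr)
      assume "x \<noteq> 0"
      then have "(1 / norm x) *\<^sub>R x \<in> ?S" using sub(2)[OF that that] by simp
      then show False using True by simp
    qed
    then show thesis using nn by (intro that[of 1]) fastforce+
  next
    case False
    obtain m where m: "m \<in> ?S" "\<And>y. y \<in> ?S \<Longrightarrow> \<nu> m \<le> \<nu> y"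
      using continuous_attains_inf[OF comp False cont] by blast
    have "0 < \<nu> m" using m(1) nn[of m] z[of m] by fastforce
    moreover have "\<nu> m * norm x \<le> \<nu> x" if x: "x \<in> ?V" for x
    proof (cases "x = 0")
      case False
      then have "(1 / norm x) *\<^sub>R x \<in> ?S" using sub(2)[OF x x] by simp
      from m(2)[OF this] show ?thesis using False hom[OF x] by (simp add: field_simps)
    qed (use nn x in auto)
    ultimately show thesis by (rule that)
  qed
qed

text \<open>The least of finitely many constants works because \<open>P i\<close> passes to smaller
  ones; inserting 1 keeps the minimum defined when \<open>I\<close> is empty.\<close>

lemma uniform_pos_constant:
  fixes P :: "'i \<Rightarrow> real \<Rightarrow> bool"
  assumes "finite I" "\<And>i. i \<in> I \<Longrightarrow> \<exists>c>0. P i c"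
    and "\<And>i c c'. i \<in> I \<Longrightarrow> P i c \<Longrightarrow> 0 < c' \<Longrightarrow> c' \<le> c \<Longrightarrow> P i c'"
  obtains c where "0 < c" "\<And>i. i \<in> I \<Longrightarrow> P i c"
proof -
  obtain f where f: "\<And>i. i \<in> I \<Longrightarrow> 0 < f i \<and> P i (f i)" using assms(2) by metis
  have c: "0 < Min (insert 1 (f ` I))" using f assms(1) by auto
  have "P i (Min (insert 1 (f ` I)))" if "i \<in> I" for i
  proof (rule assms(3)[OF that])
    show "P i (f i)" using f that by simp
    show "Min (insert 1 (f ` I)) \<le> f i" using that assms(1) by (intro Min_le) auto
  qed (rule c)
  then show thesis using c that by blast
qed

lemma admissible_metrics_ge_norm:
  assumes "admissible_metrics N b D"
  obtains \<kappa> where "0 < \<kappa>"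
    "\<And>i d x y. i \<in> {1..N} \<Longrightarrow> d \<in> D i \<Longrightarrow> x \<in> block b i \<Longrightarrow> y \<in> block b i \<Longrightarrow> \<kappa> * norm (x - y) \<le> d x y"
proof -
  define P where "P = (\<lambda>i \<kappa>. \<forall>d\<in>D i. \<forall>x\<in>block b i. \<forall>y\<in>block b i. \<kappa> * norm (x - y) \<le> d x y)"
  have 1: "\<exists>\<kappa>>0. P i \<kappa>" if i: "i \<in> {1..N}" for i
  proof -
    obtain \<nu> C where \<nu>: "norm_on (block b i) \<nu>" "0 < C"
      "\<And>d x y. d\<in>D i \<Longrightarrow> x\<in>block b i \<Longrightarrow> y\<in>block b i \<Longrightarrow> C * \<nu> (x - y) \<le> d x y"
      using assms i unfolding admissible_metrics_def by metis
    obtain c where c: "0 < c" "\<And>x. x \<in> block b i \<Longrightarrow> c * norm x \<le> \<nu> x"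
      using norm_on_ge_norm[OF \<nu>(1)] by blast
    have "C * c * norm (x - y) \<le> d x y" if "d\<in>D i" "x\<in>block b i" "y\<in>block b i" for d x y
      using mult_left_mono[OF c(2)[OF subspace_diff[OF subspace_block that(2,3)]], of C] \<nu>(2) \<nu>(3)[OF that]
      unfolding mult.assoc by linarith
    then show ?thesis unfolding P_def using c(1) \<nu>(2) by (intro exI[of _ "C * c"]) simp
  qed
  have 2: "P i \<kappa>'" if "P i \<kappa>" "\<kappa>' \<le> \<kappa>" for i \<kappa> \<kappa>'
    using that(1) order_trans[OF mult_right_mono[OF that(2) norm_ge_zero]] unfolding P_def by blast
  obtain \<kappa> where "0 < \<kappa>" "\<And>i. i \<in> {1..N} \<Longrightarrow> P i \<kappa>"
    by (rule uniform_pos_constant[of "{1..N}" P]) (use 1 2 in simp_all)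
  then show thesis using that unfolding P_def by blast
qed

lemma admissible_metrics_bounded:
  fixes b :: "'n::finite \<Rightarrow> nat"
  assumes "admissible_metrics N b D"
  obtains M where "0 \<le> M"
    "\<And>i d x y. i \<in> {1..N} \<Longrightarrow> d \<in> D i \<Longrightarrow> x \<in> block b i \<Longrightarrow> y \<in> block b i \<Longrightarrow>
      norm x \<le> r \<Longrightarrow> norm y \<le> r \<Longrightarrow> d x y \<le> M"
proof -
  let ?K = "\<lambda>i. block b i \<inter> cball 0 r"
  have "\<exists>M. \<forall>d\<in>D i. \<forall>x\<in>?K i. \<forall>y\<in>?K i. d x y \<le> M" if i: "i \<in> {1..N}" for i
  proof -
    have "compact (?K i \<times> ?K i)"
      by (intro compact_Times closed_Int_compact closed_subspace subspace_block compact_cball)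
    moreover have "?K i \<times> ?K i \<subseteq> block b i \<times> block b i" by blast
    moreover have "\<forall>K. compact K \<and> K \<subseteq> block b i \<times> block b i \<longrightarrow>
        (\<exists>M::real. \<forall>(x, y)\<in>K. (SUP d\<in>D i. ereal (d x y)) \<le> ereal M)"
      using assms i unfolding admissible_metrics_def by blast
    ultimately obtain M :: real where
      "\<forall>(x, y)\<in>?K i \<times> ?K i. (SUP d\<in>D i. ereal (d x y)) \<le> ereal M" by meson
    then have "d x y \<le> M" if "d\<in>D i" "x\<in>?K i" "y\<in>?K i" for d x y
      using that by (fastforce simp: SUP_le_iff)
    then show ?thesis by blast
  qed
  then obtain M where M: "\<And>i. i \<in> {1..N} \<Longrightarrow> \<forall>d\<in>D i. \<forall>x\<in>?K i. \<forall>y\<in>?K i. d x y \<le> M i" by metis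
  show thesis
  proof (rule that[of "\<Sum>i=1..N. \<bar>M i\<bar>"])
    fix i d x y
    assume *: "i \<in> {1..N}" "d \<in> D i" "x \<in> block b i" "y \<in> block b i" "norm x \<le> r" "norm y \<le> r"
    then have "d x y \<le> M i" using M[of i] by auto
    also have "M i \<le> \<bar>M i\<bar>" by simp
    also have "\<dots> \<le> (\<Sum>i=1..N. \<bar>M i\<bar>)" using * by (intro member_le_sum) auto
    finally show "d x y \<le> (\<Sum>i=1..N. \<bar>M i\<bar>)" .
  qed (simp add: sum_nonneg)
qed

section \<open>One pass over the blocks\<close>

text \<open>Prolong the segment from \<open>v\<close> through \<open>u\<close> to length 1: at its
  endpoint \<open>w\<close> the function is at most \<open>B\<close>, and \<open>u\<close> is the
  convex combination giving \<open>w\<close> the weight \<open>norm (u - v)\<close>. A bound on a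
  unit ball thus becomes a Lipschitz estimate at \<open>v\<close>.\<close>

lemma convex_on_chord_bound:
  assumes f: "convex_on V f" and V: "subspace V" and uv: "u \<in> V" "v \<in> V"
    and t: "norm (u - v) \<le> 1"
    and B: "\<And>w. w \<in> V \<Longrightarrow> norm (w - v) \<le> 1 \<Longrightarrow> f w \<le> B"
  shows "f u \<le> (1 - norm (u - v)) * f v + norm (u - v) * B"
proof (cases "u = v")
  case False
  define w where "w = v + (1 / norm (u - v)) *\<^sub>R (u - v)"
  have w: "w \<in> V" unfolding w_def using V uv by (intro subspace_add subspace_scale subspace_diff)
  have u: "u = (1 - norm (u - v)) *\<^sub>R v + norm (u - v) *\<^sub>R w"
    using False by (simp add: w_def algebra_simps)
  have "f u \<le> (1 - norm (u - v)) * f v + norm (u - v) * f w"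
    using convex_onD[OF f, of "norm (u - v)" v w] t w uv u by simp
  also have "f w \<le> B" using w False by (intro B) (auto simp: w_def)
  finally show ?thesis by (simp add: mult_left_mono)
qed simp

text \<open>The operator cancels its inverse, and the gradient of the partial function is the
  projection of \<open>grad H m\<close>, which pairs with block vectors just as
  \<open>grad H m\<close> does. This rewrites the update with the Euclidean inner product.\<close>

lemma block_updateD:
  fixes b :: "'n::finite \<Rightarrow> nat"
  assumes upd: "block_update b H F D i p y x x'" and H: "\<And>w. GDERIV H w :> grad H w"
  defines "m \<equiv> with_block b i (proj b i y) (mixed b i x' x)"
  shows block_update_min: "\<And>c. c \<in> block b i \<Longrightarrow>
      F i (proj b i x') + ereal (1 / (2 * step_\<sigma> p) * (met_d p (proj b i x') (proj b i y))\<^sup>2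
          + grad H m \<bullet> (proj b i x' - proj b i y))
      \<le> F i c + ereal (1 / (2 * step_\<sigma> p) * (met_d p c (proj b i y))\<^sup>2 + grad H m \<bullet> (c - proj b i y))"
    and block_update_upper: "\<And>v. v \<in> block b i \<Longrightarrow> H (with_block b i v (mixed b i x' x))
      \<le> H m + grad H m \<bullet> (v - proj b i y) + con_L p / 2 * (met_d p v (proj b i y))\<^sup>2"
    and block_update_metric: "met_d p \<in> D i"
    and block_update_params: "0 < con_L p" "con_L p < par_s p" "1 < par_\<gamma> p"
proof -
  let ?V = "block b i"
  let ?h = "\<lambda>c. H (with_block b i c (mixed b i x' x))"
  let ?G = "\<lambda>u. inv_into ?V (op_R p) (grad ?h u)"
  note U = upd[unfolded block_update_def Let_def]
  have ip: "op_R p (?G (proj b i y)) \<bullet> (c - proj b i y) = grad H m \<bullet> (c - proj b i y)"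
    if c: "c \<in> ?V" for c
  proof -
    have g: "grad ?h (proj b i y) = proj b i (grad H m)"
      unfolding m_def by (rule grad_with_block[OF H])
    have "spd_on ?V (op_R p)" using U by blast
    then have "op_R p (?G (proj b i y)) = proj b i (grad H m)"
      unfolding g by (rule spd_on_inv_into[OF _ subspace_block proj_in_block])
    moreover have "proj b i (c - proj b i y) = c - proj b i y"
      by (intro proj_block subspace_diff[OF subspace_block] c proj_in_block)
    ultimately show ?thesis by (simp add: inner_proj)
  qed
  {
    fix c assume c: "c \<in> ?V"
    from U have "is_arg_min
          (\<lambda>c. F i c + ereal (1 / (2 * step_\<sigma> p) * (met_d p c (proj b i y))\<^sup>2
                              + op_R p (?G (proj b i y)) \<bullet> (c - proj b i y)))
          (\<lambda>c. c \<in> ?V) (proj b i x')" by blast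
    then show "F i (proj b i x') + ereal (1 / (2 * step_\<sigma> p) * (met_d p (proj b i x') (proj b i y))\<^sup>2
          + grad H m \<bullet> (proj b i x' - proj b i y))
      \<le> F i c + ereal (1 / (2 * step_\<sigma> p) * (met_d p c (proj b i y))\<^sup>2 + grad H m \<bullet> (c - proj b i y))"
      using c unfolding is_arg_min_def by (simp add: ip not_less)
  next
    fix v assume v: "v \<in> ?V"
    from U have "\<forall>u\<in>?V. \<forall>v\<in>?V. ?h v \<le> ?h u + op_R p (?G u) \<bullet> (v - u) + con_L p / 2 * (met_d p v u)\<^sup>2"
      by blast
    then have "?h v \<le> ?h (proj b i y) + op_R p (?G (proj b i y)) \<bullet> (v - proj b i y)
        + con_L p / 2 * (met_d p v (proj b i y))\<^sup>2"
      using v proj_in_block by blast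
    then show "?h v \<le> H m + grad H m \<bullet> (v - proj b i y) + con_L p / 2 * (met_d p v (proj b i y))\<^sup>2"
      unfolding ip[OF v] m_def .
  }
  show "met_d p \<in> D i" "0 < con_L p" "con_L p < par_s p" "1 < par_\<gamma> p" using U by blast+
qed

section \<open>Step parameters and sufficient decrease\<close>

lemma block_update_step_pos:
  assumes "block_update b H F D i p y x x'"
  shows "0 < step_\<sigma> p" "0 < (par_\<gamma> p - 1) * par_s p"
  using assms by (auto simp: block_update_def Let_def step_\<sigma>_def)

text \<open>The old block competes with the minimiser and has proximal term 0. The proximal weight
  is \<open>par_\<gamma> p * par_s p / 2\<close>, the upper model of \<open>H\<close> costs
  \<open>con_L p / 2\<close>, and \<open>con_L p < par_s p\<close> leaves at least
  \<open>(par_\<gamma> p - 1) * par_s p / 2\<close>.\<close>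

lemma block_update_decrease:
  fixes b :: "'n::finite \<Rightarrow> nat"
  assumes upd: "block_update b H F D i p x x x'" and H: "\<And>w. GDERIV H w :> grad H w"
    and metric: "Metric_space (block b i) (met_d p)" and c: "c \<le> (par_\<gamma> p - 1) * par_s p"
  shows "F i (proj b i x') + ereal (H (mixed b (Suc i) x' x) - H (mixed b i x' x)
      + c / 2 * (met_d p (proj b i x') (proj b i x))\<^sup>2) \<le> F i (proj b i x)"
proof -
  interpret Metric_space "block b i" "met_d p" by (rule metric)
  define d where "d = met_d p (proj b i x') (proj b i x)"
  define e where "e = grad H (mixed b i x' x) \<bullet> (proj b i x' - proj b i x)"
  note params = block_update_params[OF upd H]
  have "1 / step_\<sigma> p = par_\<gamma> p * par_s p" by (simp add: step_\<sigma>_def)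
  then have \<sigma>: "1 / (2 * step_\<sigma> p) = par_\<gamma> p * par_s p / 2" by (simp add: field_simps)
  have 1: "F i (proj b i x') + ereal (par_\<gamma> p * par_s p / 2 * d\<^sup>2 + e) \<le> F i (proj b i x)"
    using block_update_min[OF upd H proj_in_block, of x] unfolding \<sigma>
    by (simp add: mixed_with_block d_def e_def)
  have "H (mixed b (Suc i) x' x) \<le> H (mixed b i x' x) + e + con_L p / 2 * d\<^sup>2"
    using block_update_upper[OF upd H proj_in_block, of x']
    by (simp add: mixed_with_block mixed_with_block' d_def e_def)
  moreover have "c / 2 + con_L p / 2 \<le> par_\<gamma> p * par_s p / 2"
    using c params by (simp add: algebra_simps)
  then have "(c / 2 + con_L p / 2) * d\<^sup>2 \<le> par_\<gamma> p * par_s p / 2 * d\<^sup>2"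
    by (rule mult_right_mono) simp
  ultimately have "H (mixed b (Suc i) x' x) - H (mixed b i x' x) + c / 2 * d\<^sup>2
      \<le> par_\<gamma> p * par_s p / 2 * d\<^sup>2 + e"
    unfolding distrib_right by linarith
  then have "F i (proj b i x') + ereal (H (mixed b (Suc i) x' x) - H (mixed b i x' x) + c / 2 * d\<^sup>2)
      \<le> F i (proj b i x') + ereal (par_\<gamma> p * par_s p / 2 * d\<^sup>2 + e)"
    by (intro add_left_mono) simp
  with 1 show ?thesis unfolding d_def by (rule order_trans[rotated])
qed

lemma bpl_pass_decrease:
  fixes b :: "'n::finite \<Rightarrow> nat"
  assumes b: "range b \<subseteq> {1..N}" and pass: "bpl_pass N b H F D P x x x'"
    and H: "\<And>w. GDERIV H w :> grad H w"
    and metric: "\<And>i d. i \<in> {1..N} \<Longrightarrow> d \<in> D i \<Longrightarrow> Metric_space (block b i) d"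
    and c: "\<And>i. i \<in> {1..N} \<Longrightarrow> c \<le> (par_\<gamma> (P i) - 1) * par_s (P i)"
  shows "objective N b H F x' + ereal (c / 2 * (\<Sum>i=1..N. (met_d (P i) (proj b i x') (proj b i x))\<^sup>2))
    \<le> objective N b H F x"
proof -
  let ?d = "\<lambda>i. (met_d (P i) (proj b i x') (proj b i x))\<^sup>2" and ?H = "\<lambda>i. H (mixed b i x' x)"
  have upd: "block_update b H F D i (P i) x x x'" if "i \<in> {1..N}" for i
    using pass that by (simp add: bpl_pass_def)
  have "(\<Sum>i=1..N. F i (proj b i x') + ereal (?H (Suc i) - ?H i + c / 2 * ?d i))
      \<le> (\<Sum>i=1..N. F i (proj b i x))"
    by (intro sum_mono block_update_decrease[OF upd H] metric c block_update_metric[OF upd H])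
  then have "(\<Sum>i=1..N. F i (proj b i x')) + ereal (\<Sum>i=1..N. ?H (Suc i) - ?H i + c / 2 * ?d i)
      \<le> (\<Sum>i=1..N. F i (proj b i x))"
    by (simp add: sum.distrib)
  moreover have "(\<Sum>i=1..N. ?H (Suc i) - ?H i + c / 2 * ?d i) = H x' - H x + c / 2 * (\<Sum>i=1..N. ?d i)"
  proof -
    \<comment> \<open>Block indices run from 1 to \<open>N\<close>, so the sweep starts at
      \<open>mixed b 1 x' x = x\<close> and ends at
      \<open>mixed b (Suc N) x' x = x'\<close>.\<close>
    have "b j \<in> {1..N}" for j using b by blast
    then have b': "\<not> b j < 1" "b j < Suc N" for j
      unfolding not_less less_Suc_eq_le by (meson atLeastAtMost_iff)+
    then have "mixed b (Suc N) x' x = x'" "mixed b 1 x' x = x"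
      by (simp_all only: mixed_def vec_eq_iff vec_lambda_beta b' if_True if_False simp_thms)
    then have "(\<Sum>i=1..N. ?H (Suc i) - ?H i) = H x' - H x"
      using sum_Suc_diff[of 1 N ?H] by simp
    then show ?thesis by (simp add: sum.distrib sum_distrib_left)
  qed
  ultimately have "ereal (H x) + ((\<Sum>i=1..N. F i (proj b i x')) + ereal (H x' - H x + c / 2 * (\<Sum>i=1..N. ?d i)))
      \<le> objective N b H F x"
    unfolding objective_def by (intro add_left_mono) simp
  also have "ereal (H x) + ((\<Sum>i=1..N. F i (proj b i x')) + ereal (H x' - H x + c / 2 * (\<Sum>i=1..N. ?d i)))
     = objective N b H F x' + ereal (c / 2 * (\<Sum>i=1..N. ?d i))"
    unfolding objective_def by (cases "\<Sum>i=1..N. F i (proj b i x')") auto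
  finally show ?thesis .
qed

section \<open>Growth of the metrics and slope at the new iterate\<close>

lemma metric_le_norm_of_convex:
  assumes "Metric_space V d" and V: "subspace V" and conv: "convex_on V (\<lambda>u. d u v)"
    and uv: "u \<in> V" "v \<in> V" and M: "\<And>w. w \<in> V \<Longrightarrow> norm (w - v) \<le> 1 \<Longrightarrow> d w v \<le> M" "d u v \<le> M"
  shows "d u v \<le> M * norm (u - v)"
proof -
  interpret Metric_space V d by fact
  show ?thesis
  \<comment> \<open>Within unit distance the chord estimate applies, without constant term since
    \<open>d v v = 0\<close>; further away \<open>M\<close> itself is at most
    \<open>M * norm (u - v)\<close>.\<close>
  proof (cases "norm (u - v) \<le> 1")
    case True
    then show ?thesis using convex_on_chord_bound[OF conv V uv True M(1)] uv by (simp add: mult.commute)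
  next
    case False
    moreover have "0 \<le> M" using M(2) nonneg[of u v] by linarith
    ultimately have "M * 1 \<le> M * norm (u - v)" by (intro mult_left_mono) auto
    then show ?thesis using M(2) by simp
  qed
qed

text \<open>The block of \<open>u\<close> competes with the minimiser. By convexity its distance to
  the block of \<open>y\<close> exceeds \<open>d\<close> by at most \<open>t * M\<close>, so
  squaring yields a linear term, which is the slope, and a quadratic one that is negligible near
  \<open>x'\<close>.\<close>

lemma block_update_slope:
  fixes b :: "'n::finite \<Rightarrow> nat"
  assumes upd: "block_update b H F D i p y x x'" and H: "\<And>w. GDERIV H w :> grad H w"
    and metric: "Metric_space (block b i) (met_d p)"
    and conv: "convex_on (block b i) (\<lambda>u. met_d p u (proj b i y))"
    and M: "0 \<le> M" "\<And>w. w \<in> block b i \<Longrightarrow> norm (w - proj b i x') \<le> 1 \<Longrightarrow> met_d p w (proj b i y) \<le> M"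
    and u: "norm (u - x') \<le> 1"
  defines "m \<equiv> with_block b i (proj b i y) (mixed b i x' x)"
    and "d \<equiv> met_d p (proj b i x') (proj b i y)" and "t \<equiv> norm (u - x')"
  shows "F i (proj b i x') \<le> F i (proj b i u) + ereal (grad H m \<bullet> proj b i (u - x')
      + t * (M / step_\<sigma> p * d) + t\<^sup>2 * (M\<^sup>2 / (2 * step_\<sigma> p)))"
proof -
  interpret Metric_space "block b i" "met_d p" by (rule metric)
  let ?p = "proj b i" and ?s = "1 / (2 * step_\<sigma> p)"
  define t' where "t' = norm (?p u - ?p x')"
  have t': "t' \<le> t" "0 \<le> t'" using norm_proj_le[of b i "u - x'"]
    by (auto simp: t'_def t_def linear_diff[OF linear_proj])
  have "met_d p (?p u) (?p y) \<le> (1 - t') * d + t' * M"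
    unfolding t'_def d_def
    by (rule convex_on_chord_bound[OF conv subspace_block])
      (use t' u M(2) in \<open>auto simp: t'_def t_def\<close>)
  also have "\<dots> \<le> d + t * M"
    using mult_right_mono[OF t'(1) M(1)] mult_nonneg_nonneg[OF t'(2) nonneg[of "?p x'" "?p y"]]
    by (simp add: d_def algebra_simps)
  finally have "(met_d p (?p u) (?p y))\<^sup>2 \<le> (d + t * M)\<^sup>2"
    by (intro power_mono) auto
  then have "?s * (met_d p (?p u) (?p y))\<^sup>2 \<le> ?s * (d + t * M)\<^sup>2"
    using block_update_step_pos(1)[OF upd] by (intro mult_left_mono) auto
  also have "\<dots> = ?s * d\<^sup>2 + t * (M / step_\<sigma> p * d) + t\<^sup>2 * (M\<^sup>2 / (2 * step_\<sigma> p))"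
    using block_update_step_pos(1)[OF upd] by (simp add: field_simps power2_eq_square)
  finally have le: "?s * (met_d p (?p u) (?p y))\<^sup>2 + grad H m \<bullet> (?p u - ?p y)
    - (?s * d\<^sup>2 + grad H m \<bullet> (?p x' - ?p y))
    \<le> grad H m \<bullet> ?p (u - x') + t * (M / step_\<sigma> p * d) + t\<^sup>2 * (M\<^sup>2 / (2 * step_\<sigma> p))"
    by (simp add: linear_diff[OF linear_proj] inner_diff_right)
  have "F i (?p x') + ereal (?s * d\<^sup>2 + grad H m \<bullet> (?p x' - ?p y))
    \<le> F i (?p u) + ereal (?s * (met_d p (?p u) (?p y))\<^sup>2 + grad H m \<bullet> (?p u - ?p y))"
    using block_update_min[OF upd H proj_in_block, of u] by (simp add: m_def d_def)
  then have "F i (?p x') \<le> F i (?p u) + ereal (?s * (met_d p (?p u) (?p y))\<^sup>2 + grad H m \<bullet> (?p u - ?p y)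
    - (?s * d\<^sup>2 + grad H m \<bullet> (?p x' - ?p y)))"
    by (cases "F i (?p x')"; cases "F i (?p u)") auto
  also have "\<dots> \<le> F i (?p u) + ereal (grad H m \<bullet> ?p (u - x') + t * (M / step_\<sigma> p * d) + t\<^sup>2 * (M\<^sup>2 / (2 * step_\<sigma> p)))"
    using le by (intro add_left_mono) simp
  finally show ?thesis .
qed

text \<open>
  The block minimality conditions add up to the minimality of a separable function at the new
  iterate, so the bound comes from the slope of the objective and no subdifferential calculus for
  sums is needed.
\<close>

lemma bpl_pass_edist_lim_subdiff:
  fixes b :: "'n::finite \<Rightarrow> nat"
  assumes b: "range b \<subseteq> {1..N}" and pass: "bpl_pass N b H F D P y x x'"
    and H: "\<And>w. GDERIV H w :> grad H w"
    and F: "admissible_terms N b F" and fin: "objective N b H F x' < \<infinity>"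
    and metric: "\<And>i d. i \<in> {1..N} \<Longrightarrow> d \<in> D i \<Longrightarrow> Metric_space (block b i) d"
    and conv: "\<And>i d v. i \<in> {1..N} \<Longrightarrow> d \<in> D i \<Longrightarrow> v \<in> block b i \<Longrightarrow> convex_on (block b i) (\<lambda>u. d u v)"
    and M: "0 \<le> M" "\<And>i d w. i \<in> {1..N} \<Longrightarrow> d \<in> D i \<Longrightarrow> w \<in> block b i \<Longrightarrow>
      norm (w - proj b i x') \<le> 1 \<Longrightarrow> d w (proj b i y) \<le> M"
  defines "m \<equiv> \<lambda>i. with_block b i (proj b i y) (mixed b i x' x)"
  shows "edist 0 (lim_subdiff (objective N b H F) x')
    \<le> ereal (\<Sum>i=1..N. norm (grad H (m i) - grad H x')
        + M / step_\<sigma> (P i) * met_d (P i) (proj b i x') (proj b i y))"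
proof -
  let ?J = "objective N b H F" and ?I = "{1..N}" and ?p = "\<lambda>i. proj b i"
  let ?d = "\<lambda>i. met_d (P i) (?p i x') (?p i y)" and ?\<sigma> = "\<lambda>i. step_\<sigma> (P i)"
  define l where "l = (\<Sum>i\<in>?I. norm (grad H (m i) - grad H x') + M / ?\<sigma> i * ?d i)"
  define q where "q = (\<Sum>i\<in>?I. M\<^sup>2 / (2 * ?\<sigma> i))"
  have upd: "block_update b H F D i (P i) y x x'" if "i \<in> ?I" for i
    using pass that by (simp add: bpl_pass_def)
  note D = block_update_metric[OF upd H]
  have F_ninf: "F i (?p i w) \<noteq> -\<infinity>" if "i \<in> ?I" for i w
    using F that by (simp add: admissible_terms_def proper_on_def)
  then have ninf: "?J w \<noteq> -\<infinity>" for w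
    using sum_ereal_neq_MInf[of ?I "\<lambda>i. F i (?p i w)"]
    by (cases "\<Sum>i=1..N. F i (?p i w)") (auto simp: objective_def)
  obtain a where a: "?J x' = ereal a" using fin ninf[of x'] by (cases "?J x'") auto
  have "isCont H w" for w using H[of w] unfolding gderiv_def by (rule has_derivative_continuous)
  then have "continuous_on UNIV H" by (simp add: continuous_on_eq_continuous_at)
  moreover have "continuous_on UNIV (?p i)" for i
    by (simp add: linear_continuous_on linear_linear linear_proj)
  ultimately have lsc: "lsc_on UNIV ?J"
    unfolding objective_def using F F_ninf
    by (intro lsc_on_add lsc_on_ereal_continuous lsc_on_sum sum_ereal_neq_MInf lsc_on_compose)
      (auto simp: admissible_terms_def)
  have d_nn: "0 \<le> M / ?\<sigma> i * ?d i" "0 \<le> M\<^sup>2 / (2 * ?\<sigma> i)" if i: "i \<in> ?I" for i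
    using Metric_space.nonneg[OF metric[OF i D[OF i]], of "?p i x'" "?p i y"] M(1)
      block_update_step_pos(1)[OF upd[OF i]] by simp_all
  have l: "0 \<le> l" unfolding l_def using d_nn by (intro sum_nonneg add_nonneg_nonneg) auto
  have q: "0 \<le> q" unfolding q_def using d_nn by (intro sum_nonneg) auto
  have "\<forall>\<^sub>F u in nhds x'. ?J x' \<le> ?J u + ereal ((l + \<epsilon>) * norm (u - x'))" if \<epsilon>: "0 < \<epsilon>" for \<epsilon>
  proof -
    obtain \<delta> where \<delta>: "0 < \<delta>" "\<And>u. norm (u - x') < \<delta> \<Longrightarrow>
        norm (H u - H x' - (u - x') \<bullet> grad H x') \<le> \<epsilon> / 2 * norm (u - x')"
      using H[of x'] \<epsilon> unfolding gderiv_def has_derivative_at_alt by (meson half_gt_zero)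
    \<comment> \<open>\<open>\<delta>\<close> keeps the remainder of \<open>H\<close> below
      \<open>\<epsilon> / 2 * t\<close>, 1 is the radius on which the metrics are bounded by
      \<open>M\<close>, and the last bound makes the quadratic terms at most another
      \<open>\<epsilon> / 2 * t\<close>; \<open>q + 1\<close> avoids dividing by 0.\<close>
    define r where "r = min \<delta> (min 1 (\<epsilon> / (2 * (q + 1))))"
    have r: "0 < r" using \<delta> \<epsilon> q by (simp add: r_def)
    have "?J x' \<le> ?J u + ereal ((l + \<epsilon>) * norm (u - x'))" if u: "norm (u - x') < r" for u
    proof -
      define t where "t = norm (u - x')"
      have t: "0 \<le> t" "t < \<delta>" "t \<le> 1" "t \<le> \<epsilon> / (2 * (q + 1))" using u by (auto simp: t_def r_def)
      define e where "e = (\<lambda>i. grad H (m i) \<bullet> ?p i (u - x') + t * (M / ?\<sigma> i * ?d i) + t\<^sup>2 * (M\<^sup>2 / (2 * ?\<sigma> i)))"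
      have "F i (?p i x') \<le> F i (?p i u) + ereal (e i)" if i: "i \<in> ?I" for i
        unfolding e_def t_def m_def
        by (rule block_update_slope[OF upd[OF i] H metric[OF i D[OF i]] conv[OF i D[OF i] proj_in_block] M(1)])
          (use M(2)[OF i D[OF i]] t in \<open>auto simp: t_def\<close>)
      then have "(\<Sum>i\<in>?I. F i (?p i x')) \<le> (\<Sum>i\<in>?I. F i (?p i u) + ereal (e i))"
        by (intro sum_mono)
      then have Fle: "(\<Sum>i\<in>?I. F i (?p i x')) \<le> (\<Sum>i\<in>?I. F i (?p i u)) + ereal (\<Sum>i\<in>?I. e i)"
        by (simp add: sum.distrib)
      have "H x' - H u \<le> \<epsilon> / 2 * t - grad H x' \<bullet> (u - x')"
        using \<delta>(2)[of u] t unfolding t_def real_norm_def inner_commute[of "u - x'"] by linarith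
      \<comment> \<open>Splitting the gradient at \<open>x'\<close> over the blocks matches it with
        the linear terms of the block conditions, so that only the differences
        \<open>grad H (m i) - grad H x'\<close> remain.\<close>
      also have "grad H x' \<bullet> (u - x') = (\<Sum>i\<in>?I. grad H x' \<bullet> ?p i (u - x'))"
        unfolding inner_sum_right[symmetric] sum_proj[OF b] ..
      finally have "H x' - H u + (\<Sum>i\<in>?I. e i) \<le> \<epsilon> / 2 * t + (\<Sum>i\<in>?I. e i - grad H x' \<bullet> ?p i (u - x'))"
        by (simp add: sum_subtractf)
      also have "(\<Sum>i\<in>?I. e i - grad H x' \<bullet> ?p i (u - x'))
        \<le> (\<Sum>i\<in>?I. t * (norm (grad H (m i) - grad H x') + M / ?\<sigma> i * ?d i) + t\<^sup>2 * (M\<^sup>2 / (2 * ?\<sigma> i)))"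
      proof (rule sum_mono)
        fix i
        have "(grad H (m i) - grad H x') \<bullet> ?p i (u - x') \<le> norm (grad H (m i) - grad H x') * norm (?p i (u - x'))"
          by (rule norm_cauchy_schwarz)
        also have "\<dots> \<le> norm (grad H (m i) - grad H x') * t"
          unfolding t_def by (intro mult_left_mono norm_proj_le norm_ge_zero)
        finally show "e i - grad H x' \<bullet> ?p i (u - x')
          \<le> t * (norm (grad H (m i) - grad H x') + M / ?\<sigma> i * ?d i) + t\<^sup>2 * (M\<^sup>2 / (2 * ?\<sigma> i))"
          by (simp add: e_def algebra_simps inner_diff_left)
      qed
      also have "\<dots> = t * l + t * (t * q)"
        unfolding sum.distrib[of "\<lambda>i. t * (norm (grad H (m i) - grad H x') + M / ?\<sigma> i * ?d i)"]
          l_def q_def sum_distrib_left by (simp only: power2_eq_square mult.assoc)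
      finally have 1: "H x' - H u + (\<Sum>i\<in>?I. e i) \<le> \<epsilon> / 2 * t + (t * l + t * (t * q))" by simp
      have "t * q \<le> \<epsilon> / 2"
      proof -
        have "t * q \<le> t * (q + 1)" using t by (simp add: algebra_simps)
        also have "\<dots> \<le> \<epsilon> / (2 * (q + 1)) * (q + 1)" using t q by (intro mult_right_mono) auto
        also have "\<dots> = \<epsilon> / 2" using q by (simp add: divide_simps)
        finally show ?thesis .
      qed
      then have "t * (t * q) \<le> t * (\<epsilon> / 2)" using t(1) by (rule mult_left_mono)
      with 1 have le: "H x' - H u + (\<Sum>i\<in>?I. e i) \<le> (l + \<epsilon>) * t"
        by (simp add: algebra_simps)
      have "?J x' \<le> ereal (H x') + ((\<Sum>i\<in>?I. F i (?p i u)) + ereal (\<Sum>i\<in>?I. e i))"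
        unfolding objective_def by (intro add_left_mono Fle)
      also have "\<dots> = ?J u + ereal (H x' - H u + (\<Sum>i\<in>?I. e i))"
        unfolding objective_def by (cases "\<Sum>i\<in>?I. F i (?p i u)") auto
      also have "\<dots> \<le> ?J u + ereal ((l + \<epsilon>) * t)" using le by (intro add_left_mono) simp
      finally show ?thesis by (simp add: t_def)
    qed
    then show ?thesis using r by (auto simp: eventually_nhds_metric dist_norm)
  qed
  from edist_lim_subdiff_le_slope[OF lsc ninf a l this] show ?thesis by (simp add: l_def)
qed

section \<open>Rates\<close>

lemma ex_le_average:
  fixes f :: "nat \<Rightarrow> real"
  assumes "1 \<le> K" "(\<Sum>k=1..K. f k) \<le> R"
  obtains k where "1 \<le> k" "k \<le> K" "f k \<le> R / K"
proof (rule ccontr)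
  assume "\<not> thesis"
  with that have "R / K < f k" if "k \<in> {1..K}" for k
    using \<open>k \<in> {1..K}\<close> by (meson atLeastAtMost_iff not_less)
  then have "(\<Sum>k=1..K. R / K) < (\<Sum>k=1..K. f k)" using assms by (intro sum_strict_mono) auto
  then show False using assms by simp
qed

lemma nat_ceiling_bound:
  fixes R \<epsilon> :: real
  assumes "0 \<le> R" "0 < \<epsilon>"
  obtains K :: nat where "1 \<le> K" "R / K \<le> \<epsilon>" "real K \<le> R / \<epsilon> + 2"
proof -
  define K where "K = nat \<lceil>R / \<epsilon>\<rceil> + 1"
  have "0 \<le> R / \<epsilon>" using assms by simp
  then have "R / \<epsilon> \<le> K" "real K \<le> R / \<epsilon> + 2" unfolding K_def by linarith+
  moreover have "1 \<le> K" by (simp add: K_def)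
  ultimately show thesis using assms by (intro that[of K]) (simp_all add: field_simps)
qed

text \<open>The rates, once the algorithm is reduced to values \<open>j\<close> and subgradient
  bounds \<open>l\<close>. Each estimate spans two decreases, those of the current step and of the
  preceding one used for extrapolation; \<open>j 0 = j 1\<close> makes the preceding one vanish at
  \<open>k = 1\<close>.\<close>

lemma iteration_complexity_of_gaps:
  assumes j: "\<And>k. J (z k) = ereal (j k)" and dec: "\<And>k. j (Suc k) \<le> j k" and low: "\<And>k. m \<le> j k"
    and j01: "j 0 = j 1" and C: "0 \<le> C"
    and \<Delta>: "\<And>k. 1 \<le> k \<Longrightarrow> edist 0 (lim_subdiff J (z (k + 1))) \<le> ereal (l k)"
    and l: "\<And>k. 1 \<le> k \<Longrightarrow> 0 \<le> l k" "\<And>k. 1 \<le> k \<Longrightarrow> (l k)\<^sup>2 \<le> C * (j (k - 1) - j (k + 1))"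
  shows "iteration_complexity J z"
proof -
  let ?\<Delta> = "\<lambda>k. edist 0 (lim_subdiff J (z (k + 1)))"
  have "decseq j" using dec by (rule decseq_SucI)
  then obtain js where js: "j \<longlonglongrightarrow> js" and js_le: "js \<le> j k" for k
    using decseq_convergent[of j m] low by blast
  \<comment> \<open>Each decrease is counted at most twice, hence the factor 2; adding 1 makes the
    constant positive even for \<open>C = 0\<close>.\<close>
  define C' where "C' = 2 * C + 1"
  define R where "R = C' * (j 1 - js)"
  have C': "0 < C'" and R: "0 \<le> R" using C js_le[of 1] by (auto simp: C'_def R_def)
  have telescope: "(\<Sum>k=1..K. j (k - 1) - j (k + 1)) = j 0 + j 1 - j K - j (Suc K)" for K
    by (induction K) auto
  have sum_le: "(\<Sum>k=1..K. (l k)\<^sup>2) \<le> R" for K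
  proof -
    have "(\<Sum>k=1..K. (l k)\<^sup>2) \<le> (\<Sum>k=1..K. C * (j (k - 1) - j (k + 1)))"
      using l by (intro sum_mono) auto
    also have "\<dots> = C * (j 0 + j 1 - j K - j (Suc K))"
      by (simp only: sum_distrib_left[symmetric] telescope)
    also have "\<dots> \<le> C * (2 * (j 1 - js))"
      using js_le[of K] js_le[of "Suc K"] j01 C by (intro mult_left_mono) auto
    also have "\<dots> \<le> R" using js_le[of 1] by (simp add: R_def C'_def algebra_simps)
    finally show ?thesis .
  qed
  have nonneg: "0 \<le> ?\<Delta> k" for k unfolding edist_def by (rule INF_greatest) simp
  have good: "\<exists>k. 1 \<le> k \<and> k \<le> K \<and> ?\<Delta> k \<le> ereal (l k) \<and> 0 \<le> l k \<and> (l k)\<^sup>2 \<le> R / K" if "1 \<le> K" for K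
    using ex_le_average[OF that sum_le[of K]] \<Delta> l by metis
  have sq: "(?\<Delta> k)\<^sup>2 \<le> ereal ((l k)\<^sup>2)" if "?\<Delta> k \<le> ereal (l k)" for k
    using ereal_mult_mono'[OF nonneg nonneg that that] by (simp add: power2_eq_square)
  have count: "\<exists>k. 1 \<le> k \<and> ?\<Delta> k \<le> ereal (l k) \<and> 0 \<le> l k \<and> (l k)\<^sup>2 \<le> \<epsilon> \<and> real k \<le> R / \<epsilon> + 2"
    if \<epsilon>: "0 < \<epsilon>" for \<epsilon>
  proof -
    obtain K :: nat where K: "1 \<le> K" "R / K \<le> \<epsilon>" "real K \<le> R / \<epsilon> + 2"
      using nat_ceiling_bound[OF R \<epsilon>] by metis
    from good[OF K(1)] obtain k where k: "1 \<le> k" "k \<le> K" "?\<Delta> k \<le> ereal (l k)" "0 \<le> l k" "(l k)\<^sup>2 \<le> R / K"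
      by auto
    have "real k \<le> real K" using k by simp
    then show ?thesis using k K by (intro exI[of _ k]) linarith
  qed
  have Jlim: "(\<lambda>k. J (z k)) \<longlonglongrightarrow> ereal js" using js by (simp add: j)
  have min: "(MIN k\<in>{1..K}. (?\<Delta> k)\<^sup>2) \<le> ereal C' * (J (z 1) - ereal js) / ereal (real K)" if K: "1 \<le> K" for K
  proof -
    from good[OF K] obtain k where k: "1 \<le> k" "k \<le> K" "?\<Delta> k \<le> ereal (l k)" "(l k)\<^sup>2 \<le> R / K" by auto
    have "(MIN k\<in>{1..K}. (?\<Delta> k)\<^sup>2) \<le> (?\<Delta> k)\<^sup>2" using k by (intro Min_le) auto
    also have "\<dots> \<le> ereal (R / K)" using sq[OF k(3)] k(4) by (meson ereal_less_eq(3) order_trans)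
    also have "\<dots> = ereal C' * (J (z 1) - ereal js) / ereal (real K)"
      using K by (simp add: j R_def)
    finally show ?thesis .
  qed
  have small2: "\<exists>k\<ge>1. (?\<Delta> k)\<^sup>2 \<le> ereal \<epsilon> \<and> real k \<le> R / \<epsilon> + 2" if "0 < \<epsilon>" for \<epsilon>
    using count[OF that] sq by (meson ereal_less_eq(3) order_trans)
  have small1: "\<exists>k\<ge>1. ?\<Delta> k \<le> ereal \<epsilon> \<and> real k \<le> R / \<epsilon>\<^sup>2 + 2" if \<epsilon>: "0 < \<epsilon>" for \<epsilon>
  proof -
    \<comment> \<open>A distance of at most \<open>\<epsilon>\<close> amounts to a squared distance
      of at most \<open>\<epsilon>\<^sup>2\<close>; this is where the exponent of the second rate
      comes from.\<close>
    from count[of "\<epsilon>\<^sup>2"] \<epsilon> obtain k where k: "1 \<le> k" "?\<Delta> k \<le> ereal (l k)" "(l k)\<^sup>2 \<le> \<epsilon>\<^sup>2"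
      "real k \<le> R / \<epsilon>\<^sup>2 + 2" by auto
    have "l k \<le> \<epsilon>" using power2_le_imp_le[OF k(3)] \<epsilon> by simp
    then show ?thesis using k by (meson ereal_less_eq(3) order_trans)
  qed
  \<comment> \<open>Used with \<open>n = 1\<close> for the squared distance and \<open>n = 2\<close>
    for the distance. For \<open>\<epsilon> < 1\<close> the additive 2 is absorbed by
    \<open>2 / \<epsilon> ^ n\<close>.\<close>
  have bigo: "(\<lambda>\<epsilon>. real (LEAST k. 1 \<le> k \<and> Q \<epsilon> k)) \<in> O[at_right 0](\<lambda>\<epsilon>. 1 / \<epsilon> ^ n)"
    if Q: "\<And>\<epsilon>. 0 < \<epsilon> \<Longrightarrow> \<exists>k\<ge>1. Q \<epsilon> k \<and> real k \<le> R / \<epsilon> ^ n + 2" for Q n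
  proof (rule bigoI)
    show "\<forall>\<^sub>F \<epsilon> in at_right 0. norm (real (LEAST k. 1 \<le> k \<and> Q \<epsilon> k)) \<le> (R + 2) * norm (1 / \<epsilon> ^ n)"
      unfolding eventually_at_right_field
    proof (intro exI[of _ 1] conjI allI impI)
      fix \<epsilon> :: real assume \<epsilon>: "0 < \<epsilon>" "\<epsilon> < 1"
      obtain k where k: "1 \<le> k" "Q \<epsilon> k" "real k \<le> R / \<epsilon> ^ n + 2" using Q[OF \<epsilon>(1)] by auto
      have "(LEAST k. 1 \<le> k \<and> Q \<epsilon> k) \<le> k" using k by (intro Least_le) simp
      then have "real (LEAST k. 1 \<le> k \<and> Q \<epsilon> k) \<le> R / \<epsilon> ^ n + 2" using k by linarith
      also have "2 \<le> 2 / \<epsilon> ^ n" using \<epsilon> by (simp add: field_simps power_le_one)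
      finally show "norm (real (LEAST k. 1 \<le> k \<and> Q \<epsilon> k)) \<le> (R + 2) * norm (1 / \<epsilon> ^ n)"
        using \<epsilon> by (simp add: field_simps)
    qed simp
  qed
  show ?thesis
    unfolding iteration_complexity_def Let_def
    using Jlim min C' small1 small2
      bigo[of "\<lambda>\<epsilon> k. (?\<Delta> k)\<^sup>2 \<le> ereal \<epsilon>" 1, unfolded power_one_right, OF small2]
      bigo[of "\<lambda>\<epsilon> k. ?\<Delta> k \<le> ereal \<epsilon>" 2, OF small1]
    by blast
qed

section \<open>Extrapolation weights and the descent argument\<close>

lemma tseq_nonneg: "0 \<le> tseq k"
  by (cases k) (auto intro!: add_nonneg_nonneg real_sqrt_ge_zero)

text \<open>\<open>tseq\<close> is nondecreasing because the square root is at least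
  \<open>2 * tseq n\<close>. Extrapolation thus moves by at most the length of the previous step. At
  \<open>k = 0\<close> the quotient is \<open>0 / 0 = 0\<close>.\<close>

lemma inertia_bounds: "0 \<le> inertia k" "inertia k \<le> 1"
proof -
  show "0 \<le> inertia k" by (simp add: inertia_def tseq_nonneg)
  have "tseq (k - 1) \<le> tseq k"
  proof (cases k)
    case (Suc n)
    have "2 * tseq n \<le> sqrt (1 + 4 * (tseq n)\<^sup>2)"
      by (rule real_le_rsqrt) (simp add: power_mult_distrib)
    then show ?thesis using Suc by simp
  qed simp
  then show "inertia k \<le> 1"
    using tseq_nonneg[of k] by (cases "tseq k = 0") (auto simp: inertia_def)
qed

text \<open>The argument common to both algorithms, which enter only through an extrapolation weight
  in \<open>[0, 1]\<close>, a decrease constant \<open>a\<close> and a lower bound on the step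
  sizes. The subgradient distance is bounded linearly in square roots of two successive
  decreases.\<close>

lemma iteration_complexity_of_descent:
  fixes b :: "'n::finite \<Rightarrow> nat" and z :: "nat \<Rightarrow> real ^ 'n"
  assumes b: "range b \<subseteq> {1..N}" and H: "smooth_coupling N b H" and F: "admissible_terms N b F"
    and adm: "admissible_objective (objective N b H F)" and met: "admissible_metrics N b D"
    and z01: "z 1 = z 0" and fin: "objective N b H F (z 1) < \<infinity>"
    and pos: "0 < a" "0 < \<sigma>\<^sub>0"
    and pass: "\<And>k. 1 \<le> k \<Longrightarrow> \<exists>\<beta>. 0 \<le> \<beta> \<and> \<beta> \<le> 1 \<and>
      bpl_pass N b H F D (P k) (z k + \<beta> *\<^sub>R (z k - z (k - 1))) (z k) (z (k + 1))"
    and decr: "\<And>k. 1 \<le> k \<Longrightarrow> objective N b H F (z (k + 1))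
      + ereal (a * (\<Sum>i=1..N. (met_d (P k i) (proj b i (z (k + 1))) (proj b i (z k)))\<^sup>2))
      \<le> objective N b H F (z k)"
    and \<sigma>: "\<And>k i. 1 \<le> k \<Longrightarrow> i \<in> {1..N} \<Longrightarrow> \<sigma>\<^sub>0 \<le> step_\<sigma> (P k i)"
  shows "iteration_complexity (objective N b H F) z"
proof -
  let ?J = "objective N b H F" and ?I = "{1..N}" and ?p = "\<lambda>i. proj b i"
  let ?d = "\<lambda>k i. met_d (P k i) (?p i (z (k + 1))) (?p i (z k))"
  note Hgrad = GDERIV_grad[OF H]
  have metric: "Metric_space (block b i) d" if "i \<in> ?I" "d \<in> D i" for i d
    using met that unfolding admissible_metrics_def by blast
  have conv: "convex_on (block b i) (\<lambda>u. d u v)" if "i \<in> ?I" "d \<in> D i" "v \<in> block b i" for i d v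
    using met that unfolding admissible_metrics_def by blast
  have metD: "met_d (P k i) \<in> D i" if k: "1 \<le> k" and i: "i \<in> ?I" for k i
  proof -
    obtain y where "block_update b H F D i (P k i) y (z k) (z (k + 1))"
      using pass[OF k] i unfolding bpl_pass_def by blast
    then show ?thesis by (rule block_update_metric[OF _ Hgrad])
  qed
  obtain low where low: "ereal low \<le> ?J w" for w
    using adm unfolding admissible_objective_def bdd_below_on_def by blast
  have sq_nonneg: "0 \<le> a * (\<Sum>i=1..N. (?d k i)\<^sup>2)" for k
    using pos by (simp add: sum_nonneg)
  have J_le: "?J (z k) \<le> ?J (z 1)" for k
  proof (induction k)
    case (Suc k)
    show ?case
    proof (cases "k = 0")
      case False
      have "?J (z (Suc k)) \<le> ?J (z (Suc k)) + ereal (a * (\<Sum>i=1..N. (?d k i)\<^sup>2))"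
        using sq_nonneg[of k] ereal_le_add_self[of "ereal (a * (\<Sum>i=1..N. (?d k i)\<^sup>2))" "?J (z (Suc k))"]
        by simp
      also have "\<dots> \<le> ?J (z k)" using decr[of k] False by simp
      finally show ?thesis using Suc by simp
    qed simp
  qed (simp only: z01 order_refl)
  define j where "j = (\<lambda>k. real_of_ereal (?J (z k)))"
  have j: "?J (z k) = ereal (j k)" for k
    using low[of "z k"] J_le[of k] fin unfolding j_def by (cases "?J (z k)") auto
  have j01: "j 0 = j 1" by (simp only: j_def z01)
  have gap: "a * (\<Sum>i=1..N. (?d k i)\<^sup>2) \<le> j k - j (k + 1)" if "1 \<le> k" for k
    using decr[OF that] by (simp add: j)
  have dec: "j (Suc k) \<le> j k" for k
    using gap[of k] sq_nonneg[of k] j01 by (cases "k = 0") auto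

  \<comment> \<open>The values never exceed \<open>?J (z 1)\<close>, so coercivity keeps all
    iterates in one ball.\<close>
  obtain B where B: "\<And>k. norm (z k) \<le> B"
  proof -
    have "(?J \<longlongrightarrow> \<infinity>) at_infinity" using adm by (simp add: admissible_objective_def)
    then have "\<forall>\<^sub>F w in at_infinity. ereal (j 1) < ?J w" by (rule order_tendstoD) simp
    then obtain B where "\<And>w. B \<le> norm w \<Longrightarrow> ereal (j 1) < ?J w"
      by (auto simp: eventually_at_infinity)
    then have "norm (z k) \<le> B" for k
      using J_le[of k] j[of 1] by (metis leD le_cases)
    then show thesis by (rule that)
  qed
  have B0: "0 \<le> B" using norm_ge_zero[of "z 0"] B[of 0] by linarith
  \<comment> \<open>Steps have length at most \<open>2 * B\<close>, so extrapolated points have norm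
    at most \<open>3 * B\<close>; the extra 1 admits the unit neighbourhoods of the convexity
    estimates.\<close>
  obtain M where M: "0 \<le> M" "\<And>i d x y. i \<in> ?I \<Longrightarrow> d \<in> D i \<Longrightarrow> x \<in> block b i \<Longrightarrow> y \<in> block b i \<Longrightarrow>
      norm x \<le> 3 * B + 1 \<Longrightarrow> norm y \<le> 3 * B + 1 \<Longrightarrow> d x y \<le> M"
    using admissible_metrics_bounded[OF met] by blast
  obtain \<kappa> where \<kappa>: "0 < \<kappa>" "\<And>i d x y. i \<in> ?I \<Longrightarrow> d \<in> D i \<Longrightarrow> x \<in> block b i \<Longrightarrow> y \<in> block b i \<Longrightarrow>
      \<kappa> * norm (x - y) \<le> d x y"
    using admissible_metrics_ge_norm[OF met] by blast
  \<comment> \<open>The intermediate points \<open>m i\<close> below lie within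
    \<open>2 * s + s' \<le> 6 * B\<close> of the new iterate, hence in the ball of radius
    \<open>7 * B\<close>.\<close>
  obtain \<Lambda> where \<Lambda>: "\<Lambda>-lipschitz_on (cball 0 (7 * B)) (grad H)"
    using H bounded_cball unfolding smooth_coupling_def by metis
  have \<Lambda>0: "0 \<le> \<Lambda>" using \<Lambda> by (simp add: lipschitz_on_def)

  \<comment> \<open>Cauchy-Schwarz over the \<open>N\<close> blocks turns the bound on the sum of
    squared distances into one on the sum of distances, at the cost of the factor
    \<open>N\<close>.\<close>
  define E where "E = (\<lambda>k. sqrt (N * (j k - j (k + 1)) / a))"
  have E0: "0 \<le> E k" for k using dec[of k] pos by (simp add: E_def)
  have d_sum: "(\<Sum>i\<in>?I. ?d k i) \<le> E k" if k: "1 \<le> k" for k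
  proof -
    have "a * (\<Sum>i\<in>?I. ?d k i)\<^sup>2 \<le> a * (N * (\<Sum>i\<in>?I. (?d k i)\<^sup>2))"
      using sum_squared_le_sum_of_squares[of "?d k" ?I] pos by (intro mult_left_mono) (auto simp: mult.commute)
    also have "\<dots> \<le> N * (j k - j (k + 1))"
      using mult_left_mono[OF gap[OF k], of "real N"] by (simp add: mult.left_commute)
    finally have "(\<Sum>i\<in>?I. ?d k i)\<^sup>2 \<le> N * (j k - j (k + 1)) / a"
      using pos by (simp add: pos_le_divide_eq mult.commute)
    then show ?thesis unfolding E_def by (rule real_le_rsqrt)
  qed
  have s_le: "norm (z (k + 1) - z k) \<le> E k / \<kappa>" for k
  proof (cases "k = 0")
    \<comment> \<open>Index 0 occurs because the first extrapolation looks back to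
      \<open>z 0\<close>; the step is zero there as \<open>z 1 = z 0\<close>.\<close>
    case True
    then show ?thesis using E0[of k] \<kappa> z01 by simp
  next
    case False
    then have k: "1 \<le> k" by simp
    have "\<kappa> * norm (z (k + 1) - z k) = \<kappa> * norm (\<Sum>i\<in>?I. ?p i (z (k + 1) - z k))"
      by (simp only: sum_proj[OF b])
    also have "\<dots> \<le> \<kappa> * (\<Sum>i\<in>?I. norm (?p i (z (k + 1) - z k)))"
      using \<kappa> by (intro mult_left_mono norm_sum) auto
    also have "\<dots> = (\<Sum>i\<in>?I. \<kappa> * norm (?p i (z (k + 1)) - ?p i (z k)))"
      by (simp add: sum_distrib_left linear_diff[OF linear_proj])
    also have "\<dots> \<le> (\<Sum>i\<in>?I. ?d k i)"
      by (intro sum_mono \<kappa>(2)[OF _ metD[OF k]] proj_in_block)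
    also have "\<dots> \<le> E k" by (rule d_sum[OF k])
    finally show ?thesis using \<kappa> by (simp add: pos_le_divide_eq mult.commute)
  qed

  \<comment> \<open>The first summand collects the \<open>N\<close> gradient differences, with
    \<open>2 * s + s'\<close> bounded by twice \<open>(E k + E (k - 1)) / \<kappa>\<close>; the
    second collects the metric distances to \<open>y\<close>, each block adding
    \<open>M * s'\<close> for the extrapolation.\<close>
  define A where "A = N * \<Lambda> * 2 / \<kappa> + M / \<sigma>\<^sub>0 * (1 + N * M / \<kappa>)"
  have A0: "0 \<le> A" unfolding A_def using \<Lambda>0 \<kappa> M pos by (intro add_nonneg_nonneg mult_nonneg_nonneg) auto
  define l where "l = (\<lambda>k. A * (E k + E (k - 1)))"
  have "edist 0 (lim_subdiff ?J (z (k + 1))) \<le> ereal (l k)" if k: "1 \<le> k" for k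
  proof -
    obtain \<beta> where \<beta>: "0 \<le> \<beta>" "\<beta> \<le> 1"
      and p: "bpl_pass N b H F D (P k) (z k + \<beta> *\<^sub>R (z k - z (k - 1))) (z k) (z (k + 1))"
      using pass[OF k] by auto
    define x where "x = z k"
    define x' where "x' = z (k + 1)"
    define y where "y = z k + \<beta> *\<^sub>R (z k - z (k - 1))"
    define m where "m = (\<lambda>i. with_block b i (?p i y) (mixed b i x' x))"
    define s where "s = norm (x' - x)"
    define s' where "s' = norm (x - z (k - 1))"
    have p': "bpl_pass N b H F D (P k) y x x'" using p by (simp add: x_def x'_def y_def)
    note D = metD[OF k]
    have s: "s \<le> E k / \<kappa>" "s' \<le> E (k - 1) / \<kappa>" "0 \<le> s" "0 \<le> s'"
      using s_le[of k] s_le[of "k - 1"] k by (auto simp: s_def s'_def x_def x'_def)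
    have nb: "norm x \<le> B" "norm x' \<le> B" "norm (z (k - 1)) \<le> B" by (simp_all add: x_def x'_def B)
    have sB: "s \<le> 2 * B" "s' \<le> 2 * B"
      using norm_triangle_ineq4[of x' x] norm_triangle_ineq4[of x "z (k - 1)"] nb by (auto simp: s_def s'_def)
    have "norm (y - x) = \<beta> * s'" using \<beta> by (simp add: y_def x_def s'_def)
    also have "\<dots> \<le> s'" using mult_right_mono[OF \<beta>(2) s(4)] by simp
    finally have yx: "norm (y - x) \<le> s'" .
    have ny: "norm y \<le> 3 * B" using norm_triangle_ineq2[of y x] yx nb sB by linarith
    have x'y: "norm (x' - y) \<le> s + s'"
      using norm_triangle_ineq4[of "x' - x" "y - x"] yx by (simp add: s_def)
    have grad_le: "norm (grad H (m i) - grad H x') \<le> \<Lambda> * (2 * s + s')" for i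
    proof -
      have mx': "norm (x' - m i) \<le> 2 * s + s'"
        using norm_diff_with_block_mixed_le[of x' b i y x] x'y by (simp add: m_def s_def)
      then have "norm (m i) \<le> 7 * B" using norm_triangle_ineq3[of x' "m i"] nb sB by linarith
      then have "norm (grad H (m i) - grad H x') \<le> \<Lambda> * norm (m i - x')"
        using lipschitz_onD[OF \<Lambda>, of "m i" x'] nb B0 by (simp add: dist_norm)
      also have "\<dots> \<le> \<Lambda> * (2 * s + s')"
        using mx' \<Lambda>0 by (intro mult_left_mono) (simp_all add: norm_minus_commute)
      finally show ?thesis .
    qed
    have py: "norm (?p i y) \<le> 3 * B + 1" and px: "norm (?p i x) \<le> 3 * B + 1" for i
      using norm_proj_le[of b i y] norm_proj_le[of b i x] ny nb B0 by linarith+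
    have near: "norm w \<le> 3 * B + 1" if "norm (w - ?p i v) \<le> 1" "norm v \<le> B" for w v i
      using that norm_triangle_ineq2[of w "?p i v"] norm_proj_le[of b i v] B0 by linarith
    \<comment> \<open>The triangle inequality through the block of \<open>z k\<close>: the first leg
      is controlled by the current decrease, the second by the previous step, since convexity makes
      the metric at most linear in the norm.\<close>
    have d_le: "met_d (P k i) (?p i x') (?p i y) \<le> ?d k i + M * s'" if i: "i \<in> ?I" for i
    proof -
      interpret Metric_space "block b i" "met_d (P k i)" by (rule metric[OF i D[OF i]])
      have "met_d (P k i) (?p i y) (?p i x) \<le> M * norm (?p i y - ?p i x)"
      proof (rule metric_le_norm_of_convex[OF _ subspace_block conv[OF i D[OF i]]])
        show "met_d (P k i) w (?p i x) \<le> M" if "w \<in> block b i" "norm (w - ?p i x) \<le> 1" for w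
          using that near[OF that(2) nb(1)] px by (intro M(2)[OF i D[OF i]]) auto
        show "met_d (P k i) (?p i y) (?p i x) \<le> M"
          using px py by (intro M(2)[OF i D[OF i]]) auto
      qed (use metric[OF i D[OF i]] in auto)
      also have "\<dots> \<le> M * s'"
        using norm_proj_le[of b i "y - x"] yx M(1)
        by (intro mult_left_mono) (simp_all add: linear_diff[OF linear_proj])
      finally have "met_d (P k i) (?p i x) (?p i y) \<le> M * s'" by (simp add: commute)
      then show ?thesis
        using triangle[of "?p i x'" "?p i x" "?p i y"] by (simp add: x_def x'_def)
    qed
    have "edist 0 (lim_subdiff ?J x') \<le> ereal (\<Sum>i=1..N. norm (grad H (m i) - grad H x')
        + M / step_\<sigma> (P k i) * met_d (P k i) (?p i x') (?p i y))"
      unfolding m_def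
    proof (rule bpl_pass_edist_lim_subdiff[OF b p' Hgrad F])
      show "Metric_space (block b i) d" if "i \<in> ?I" "d \<in> D i" for i d
        by (rule metric[OF that])
      show "convex_on (block b i) (\<lambda>u. d u v)" if "i \<in> ?I" "d \<in> D i" "v \<in> block b i" for i d v
        by (rule conv[OF that])
      show "?J x' < \<infinity>" by (simp only: x'_def j less_ereal.simps)
      show "d w (?p i y) \<le> M"
        if "i \<in> ?I" "d \<in> D i" "w \<in> block b i" "norm (w - ?p i x') \<le> 1" for i d w
        using that near[OF that(4) nb(2)] py by (intro M(2)[OF that(1,2)]) auto
    qed (rule M(1))
    also have "(\<Sum>i=1..N. norm (grad H (m i) - grad H x') + M / step_\<sigma> (P k i) * met_d (P k i) (?p i x') (?p i y))
      \<le> (\<Sum>i=1..N. \<Lambda> * (2 * s + s') + M / \<sigma>\<^sub>0 * (?d k i + M * s'))"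
    proof (intro sum_mono add_mono grad_le mult_mono d_le)
      fix i assume i: "i \<in> ?I"
      show "M / step_\<sigma> (P k i) \<le> M / \<sigma>\<^sub>0"
        using \<sigma>[OF k i] pos M(1) by (intro divide_left_mono) auto
      show "0 \<le> met_d (P k i) (?p i x') (?p i y)"
        by (rule Metric_space.nonneg[OF metric[OF i D[OF i]]])
    qed (use M pos in auto)
    also have "\<dots> = N * \<Lambda> * (2 * s + s') + M / \<sigma>\<^sub>0 * ((\<Sum>i=1..N. ?d k i) + N * M * s')"
      by (simp add: sum.distrib sum_distrib_left[symmetric] sum_divide_distrib[symmetric] algebra_simps)
    also have "\<dots> \<le> N * \<Lambda> * (2 * (E k / \<kappa>) + 2 * (E (k - 1) / \<kappa>))
        + M / \<sigma>\<^sub>0 * ((E k + E (k - 1)) + N * M * ((E k + E (k - 1)) / \<kappa>))"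
    proof -
      have "s' \<le> (E k + E (k - 1)) / \<kappa>" using s(2) E0[of k] \<kappa>(1)
        by (simp add: add_divide_distrib add_increasing)
      moreover have "(\<Sum>i=1..N. ?d k i) \<le> E k + E (k - 1)" using d_sum[OF k] E0[of "k - 1"] by linarith
      moreover have "s' \<le> 2 * (E (k - 1) / \<kappa>)" using s by linarith
      ultimately show ?thesis using \<Lambda>0 M(1) pos s(1)
        by (intro add_mono mult_left_mono) auto
    qed
    also have "\<dots> = l k"
      by (simp add: l_def A_def algebra_simps add_divide_distrib)
    finally show ?thesis by (simp add: x'_def)
  qed
  moreover have "0 \<le> l k" for k using A0 E0 by (simp add: l_def)
  moreover have "(l k)\<^sup>2 \<le> 2 * A\<^sup>2 * N / a * (j (k - 1) - j (k + 1))" if "1 \<le> k" for k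
  proof -
    define g where "g = j (k - 1) - j (k + 1)"
    have "(E n)\<^sup>2 = N * (j n - j (n + 1)) / a" for n
      using dec[of n] pos by (simp add: E_def)
    \<comment> \<open>Two consecutive decreases add up to a single difference of values; the square
      of a sum is at most twice the sum of the squares.\<close>
    then have E2: "(E k)\<^sup>2 + (E (k - 1))\<^sup>2 = N / a * (j (k - 1) - j (k + 1))"
      using that by (simp add: add_divide_distrib[symmetric] algebra_simps)
    have "(l k)\<^sup>2 = A\<^sup>2 * (E k + E (k - 1))\<^sup>2" by (simp add: l_def power_mult_distrib)
    also have "\<dots> \<le> A\<^sup>2 * (2 * ((E k)\<^sup>2 + (E (k - 1))\<^sup>2))"
      using sum_squares_bound[of "E k" "E (k - 1)"] by (intro mult_left_mono) (auto simp: power2_sum)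
    finally show ?thesis unfolding E2 g_def[symmetric] by (simp add: ac_simps)
  qed
  moreover have "low \<le> j k" for k using low[of "z k"] by (simp add: j)
  ultimately show ?thesis
    using pos by (intro iteration_complexity_of_gaps[OF j dec _ j01, where l = l and C = "2 * A\<^sup>2 * N / a"]) auto
qed

text \<open>Every step is an accepted inertial pass, whose decrease is read off from the test, or a
  pass without inertia, whose decrease follows from the step sizes. The algorithm without inertia
  always takes the second form.\<close>

lemma iteration_complexity_of_passes:
  fixes b :: "'n::finite \<Rightarrow> nat" and z :: "nat \<Rightarrow> real ^ 'n"
  assumes b: "range b \<subseteq> {1..N}" and H: "smooth_coupling N b H" and F: "admissible_terms N b F"
    and adm: "admissible_objective (objective N b H F)" and met: "admissible_metrics N b D"
    and \<rho>: "0 < \<rho>" and z01: "z 1 = z 0" and fin: "objective N b H F (z 1) < \<infinity>"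
    and step: "step_size_conditions N P"
    and pass: "\<And>k. 1 \<le> k \<Longrightarrow>
      bpl_pass N b H F D (P k) (z k + inertia k *\<^sub>R (z k - z (k - 1))) (z k) (z (k + 1)) \<and>
        \<not> insufficient_decrease N b (objective N b H F) \<rho> (P k) (z k) (z (k + 1)) \<or>
      bpl_pass N b H F D (P k) (z k) (z k) (z (k + 1))"
  shows "iteration_complexity (objective N b H F) z"
proof -
  let ?J = "objective N b H F"
  let ?S = "\<lambda>k. \<Sum>i=1..N. (met_d (P k i) (proj b i (z (k + 1))) (proj b i (z k)))\<^sup>2"
  have metric: "Metric_space (block b i) d" if "i \<in> {1..N}" "d \<in> D i" for i d
    using met that unfolding admissible_metrics_def by blast
  have upd: "\<exists>y. block_update b H F D i (P k i) y (z k) (z (k + 1))" if "1 \<le> k" "i \<in> {1..N}" for k i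
    using pass[OF that(1)] that(2) unfolding bpl_pass_def by blast
  define c where "c = (INF (i, k)\<in>{1..N} \<times> {1..}. (par_\<gamma> (P k i) - 1) * par_s (P k i))"
  define \<sigma>\<^sub>0 where "\<sigma>\<^sub>0 = (INF (i, k)\<in>{1..N} \<times> {1..}. step_\<sigma> (P k i))"
  have pos: "0 < c" "0 < \<sigma>\<^sub>0" using step by (simp_all add: step_size_conditions_def c_def \<sigma>\<^sub>0_def)
  \<comment> \<open>For reals, \<open>INF\<close> is a lower bound only of sets bounded below;
    positivity of the parameters provides this.\<close>
  have inf_le: "(INF (i, k)\<in>{1..N} \<times> {1..}. f i k) \<le> f i k"
    if "\<And>i k. 1 \<le> k \<Longrightarrow> i \<in> {1..N} \<Longrightarrow> 0 < f i k" "1 \<le> k" "i \<in> {1..N}" for i k and f :: "nat \<Rightarrow> nat \<Rightarrow> real"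
  proof -
    have "bdd_below ((\<lambda>(i, k). f i k) ` ({1..N} \<times> {1..}))"
      using that(1) by (intro bdd_belowI[of _ 0]) (auto intro: less_imp_le)
    from cINF_lower[OF this, of "(i, k)"] show ?thesis using that by simp
  qed
  have c: "c \<le> (par_\<gamma> (P k i) - 1) * par_s (P k i)" and \<sigma>: "\<sigma>\<^sub>0 \<le> step_\<sigma> (P k i)"
    if "1 \<le> k" "i \<in> {1..N}" for k i
    unfolding c_def \<sigma>\<^sub>0_def
    by (rule inf_le[OF _ that], use upd block_update_step_pos in blast)+
  \<comment> \<open>Either constant may govern a given step: \<open>\<rho>\<close> comes from the
    acceptance test, \<open>c / 2\<close> from the proximal terms.\<close>
  define a where "a = min \<rho> (c / 2)"
  have inert: "\<exists>\<beta>. 0 \<le> \<beta> \<and> \<beta> \<le> 1 \<and>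
      bpl_pass N b H F D (P k) (z k + \<beta> *\<^sub>R (z k - z (k - 1))) (z k) (z (k + 1))" if "1 \<le> k" for k
    using pass[OF that]
  proof (elim disjE conjE)
    assume "bpl_pass N b H F D (P k) (z k) (z k) (z (k + 1))"
    then have "bpl_pass N b H F D (P k) (z k + 0 *\<^sub>R (z k - z (k - 1))) (z k) (z (k + 1))"
      by (simp only: scaleR_zero_left add_0_right)
    then show ?thesis using order_refl[of 0] zero_le_one by blast
  qed (intro exI[of _ "inertia k"] conjI inertia_bounds)
  have decr: "?J (z (k + 1)) + ereal (a * ?S k) \<le> ?J (z k)" if k: "1 \<le> k" for k
  proof -
    have S: "0 \<le> ?S k" by (simp add: sum_nonneg)
    have "\<exists>r\<ge>a. ?J (z (k + 1)) + ereal (r * ?S k) \<le> ?J (z k)"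
      using pass[OF k]
    proof (elim disjE conjE)
      assume "\<not> insufficient_decrease N b ?J \<rho> (P k) (z k) (z (k + 1))"
      then have "?J (z (k + 1)) + ereal (\<rho> * ?S k) \<le> ?J (z k)"
        unfolding insufficient_decrease_def
        by (cases "?J (z (k + 1))"; cases "?J (z k)") auto
      then show ?thesis by (intro exI[of _ \<rho>]) (simp add: a_def)
    next
      assume "bpl_pass N b H F D (P k) (z k) (z k) (z (k + 1))"
      from bpl_pass_decrease[OF b this GDERIV_grad[OF H] metric c[OF k]]
      show ?thesis by (intro exI[of _ "c / 2"]) (simp add: a_def)
    qed
    then obtain r where r: "a \<le> r" "?J (z (k + 1)) + ereal (r * ?S k) \<le> ?J (z k)" by blast
    have "?J (z (k + 1)) + ereal (a * ?S k) \<le> ?J (z (k + 1)) + ereal (r * ?S k)"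
      using mult_right_mono[OF r(1) S] by (intro add_left_mono) simp
    then show ?thesis using r(2) by (rule order_trans)
  qed
  have "0 < a" using \<rho> pos by (simp add: a_def)
  then show ?thesis
    by (rule iteration_complexity_of_descent[OF b H F adm met z01 fin _ pos(2) inert decr \<sigma>])
qed

theorem theorem6:
  fixes N :: nat and b :: "'n::finite \<Rightarrow> nat"
    and H :: "real ^ 'n \<Rightarrow> real" and F :: "nat \<Rightarrow> real ^ 'n \<Rightarrow> ereal"
    and D :: "nat \<Rightarrow> (real ^ 'n \<Rightarrow> real ^ 'n \<Rightarrow> real) set" and \<rho> :: real
  assumes "range b \<subseteq> {1..N}"
    and "smooth_coupling N b H"
    and "admissible_terms N b F"
    and "admissible_objective (objective N b H F)"
    and "admissible_metrics N b D"
    and "0 < \<rho>"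
  shows "(\<forall>P z. iGGBPL N b H F D \<rho> P z \<and> step_size_conditions N P \<longrightarrow>
            iteration_complexity (objective N b H F) z) \<and>
         (\<forall>P z. GGBPL N b H F D P z \<and> step_size_conditions N P \<longrightarrow>
            iteration_complexity (objective N b H F) z)"
proof (intro conjI allI impI)
  fix P z assume *: "iGGBPL N b H F D \<rho> P z \<and> step_size_conditions N P"
  show "iteration_complexity (objective N b H F) z"
  proof (rule iteration_complexity_of_passes[OF assms])
    fix k :: nat assume "1 \<le> k"
    then show "bpl_pass N b H F D (P k) (z k + inertia k *\<^sub>R (z k - z (k - 1))) (z k) (z (k + 1)) \<and>
        \<not> insufficient_decrease N b (objective N b H F) \<rho> (P k) (z k) (z (k + 1)) \<or>
      bpl_pass N b H F D (P k) (z k) (z k) (z (k + 1))"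
      using * unfolding iGGBPL_def Let_def by blast
  qed (use * in \<open>auto simp: iGGBPL_def\<close>)
next
  fix P z assume *: "GGBPL N b H F D P z \<and> step_size_conditions N P"
  show "iteration_complexity (objective N b H F) z"
    by (rule iteration_complexity_of_passes[OF assms]) (use * in \<open>auto simp: GGBPL_def\<close>)
qed

end
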